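(* Let $(X,d)$ be a metric space and, for each scale $\alpha\in{}^*\mathbb R_+^*$, let $(X_\alpha,\delta_\alpha,\Delta_\alpha)$ be the $\alpha$-scaling of $(X,d)$. Then the inverse limit $\lim_{\alpha\to+\infty}(X_\alpha,\delta_\alpha,\Delta_\alpha)$ of the family of morphisms $\pi_{\beta,\alpha}:(X_\alpha,\delta_\alpha,\Delta_\alpha)\to(X_\beta,\delta_\beta,\Delta_\beta)$ ($\beta\le\alpha$ in ${}^*\mathbb R_+^*$) exists in the category $\mathcal G'_{{}^*\mathbb R}$ of generalized galactic spaces, and it is equal to $\big((X_\infty,\delta_\infty,\Delta_\infty),(\pi_{\alpha,\infty})_{\alpha\in{}^*\mathbb R_+^*}\big)$, where $(X_\infty,\delta_\infty,\Delta_\infty)$ is a generalized galactic space and the $\pi_{\alpha,\infty}$ are morphisms from $(X_\infty,\delta_\infty,\Delta_\infty)$ to $(X_\alpha,\delta_\alpha,\Delta_\alpha)$ given by: - $X_\infty$ is the set of families $\xi=(\xi_\alpha)_{\alpha\in{}^*\mathbb R_+^*}$ such that $\xi_\alpha\in X_\alpha$ for all $\alpha\in{}^*\mathbb R_+^*$ and $\pi_{\beta,\alpha}(\xi_\alpha)=\xi_\beta$ for all $\beta\le\alpha$ in ${}^*\mathbb R_+^*$; - for all $\xi,\eta\in X_\infty$, $\delta_\infty(\xi,\eta)=0$ if $\xi=\eta$ and $\delta_\infty(\xi,\eta)=+\infty$ if $\xi\ne\eta$; - for all $\xi,\eta\in X_\infty$, $\Delta_\infty(\{\xi\},\{\eta\})=0$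 if $\xi=\eta$ and $\Delta_\infty(\{\xi\},\{\eta\})=+\infty$ if $\xi\ne\eta$; - for all $\xi=(\xi_\alpha)_{\alpha}\in X_\infty$ and all $\alpha\in{}^*\mathbb R_+^*$, $\pi_{\alpha,\infty}(\xi)=\xi_\alpha$.
   Context: Fix a nonstandard model (a nonstandard extension of a superstructure over a set containing $X\cup\mathbb R$, with a sufficient saturation property, no particular refinement being required; e.g. ultrapowers over a non-principal ultrafilter on $\mathbb N$). It provides ${}^*\mathbb R$ (a proper ordered field extension of $\mathbb R$), ${}^*X$ and ${}^*d:{}^*X\times{}^*X\to{}^*\mathbb R_+$. ${}^*\mathbb R_+^*$ is the set of strictly positive elements of ${}^*\mathbb R$, called scales. An element $s\in{}^*\mathbb R$ is infinitely small ($s\simeq 0$) if $|s|<1/n$ for all integers $n\ge 1$, infinitely large if $|s|>n$ for all (standard) $n\in\mathbb N$ (written $s\simeq\pm\infty$ according to sign), and limited if it is not infinitely large. $\mathrm{Gal}(0)$ is the additive subgroup of limited elements; $\mathrm{Gal}({}^*\mathbb R)={}^*\mathbb R/\mathrm{Gal}(0)$ with canonical projection $\mathrm{Gal}$, totally ordered by $\mathrm{Gal}(s)\le\mathrm{Gal}(t)$ iff $s\le t$ or $s-t\in\mathrm{Gal}(0)$; $\mathrm{Gal}({}^*\mathbb R)_+$ is its set of elements $\ge 0$. The standard part map $\mathrm{st}$ sends limited $s$ to the unique real infinitely close to $s$ and $s\simeq\pm\infty$ to $\pm\infty$. For limited $\gamma>0$ and $\tau=\mathrm{Gal}(t)$,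 $\gamma\bullet\tau=\mathrm{Gal}(\gamma t)$; also $\gamma\bullet(+\infty)=+\infty$ and $\gamma\cdot(+\infty)=+\infty$. The symbol $+\infty$ satisfies $x<+\infty$ and $x+(+\infty)=(+\infty)+x=+\infty$. A map $d$ on $Y\times Y$ with values in $G_+$ or $G_+\cup\{+\infty\}$ ($G$ an ordered additive group) satisfies the general metric rule if for all $x,y,z$: $d(x,x)=0$; $d(x,y)=d(y,x)>0$ if $x\ne y$; $d(x,z)\le d(x,y)+d(y,z)$. A generalized distance on a set $F$ is a map $\delta:F\times F\to\mathbb R_+\cup\{+\infty\}$ satisfying this rule; the metric components of $F$ for $\delta$ are the equivalence classes of the relation $\delta(x,y)<+\infty$, and $\mathcal M_F$ is their set. A galactic space is a triple $(F,\delta,\Delta)$ with $\delta$ a generalized distance on the set $F$ and $\Delta:\mathcal M_F\times\mathcal M_F\to\mathrm{Gal}({}^*\mathbb R)_+$ satisfying the general metric rule. A generalized galactic space is defined in the same way except that $\Delta:\mathcal M_F\times\mathcal M_F\to\mathrm{Gal}({}^*\mathbb R)_+\cup\{+\infty\}$; every galactic space is one. The category $\mathcal G'_{{}^*\mathbb R}$ has as objects the generalized galactic spaces; a morphism $(F,\delta,\Delta)\to(F',\delta',\Delta')$ is a map $f:F\to F'$ for which there is a limited $\gamma>0$ in ${}^*\mathbb R$ with (1) $\delta'(f(x_1),f(x_2))\le\gamma\,\delta(x_1,x_2)$ for all $x_1,x_2\in F$ (thus $f$ induces a map $\widetilde f:\mathcal M_F\to\mathcal M_{F'}$, where $\widetilde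 f(E)$ is the component containing $f(E)$), and (2) $\Delta'(\widetilde f(E_1),\widetilde f(E_2))\le\gamma\bullet\Delta(E_1,E_2)$ for all $E_1,E_2\in\mathcal M_F$. For a scale $\alpha$, $x\simeq_\alpha y$ on ${}^*X$ means $\alpha\,{}^*d(x,y)\simeq 0$; $X_\alpha={}^*X/\!\simeq_\alpha$ with canonical projection $\pi_\alpha:{}^*X\to X_\alpha$. The $\alpha$-scaling of $(X,d)$ is the galactic space $(X_\alpha,\delta_\alpha,\Delta_\alpha)$ where $\delta_\alpha(\pi_\alpha(x),\pi_\alpha(y))=\mathrm{st}(\alpha\,{}^*d(x,y))$ and, for metric components $E_1,E_2$ of $X_\alpha$ and any $x_1,x_2\in{}^*X$ with $\pi_\alpha(x_i)\in E_i$, $\Delta_\alpha(E_1,E_2)=\mathrm{Gal}(\alpha\,{}^*d(x_1,x_2))$. For scales $\beta\le\alpha$, $\pi_{\beta,\alpha}:X_\alpha\to X_\beta$ is the unique map with $\pi_\beta=\pi_{\beta,\alpha}\circ\pi_\alpha$; it is a morphism. The inverse limit is taken over the set of scales directed by its usual order. *)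

theory Defs
  imports "HOL-Analysis.Analysis" "HOL-Library.Extended"
begin

section \<open>Nonstandard extensions\<close>

text \<open>
  First-order formulas in the language that has one symbol for every finitary relation on the
  standard universe \<open>'s\<close> (relations are sets of lists; variables are numbered).
\<close>

datatype 's form =
    Rel "'s list set" "nat list"
  | Eq nat nat
  | Neg "'s form"
  | Conj "'s form" "'s form"
  | Forall nat "'s form"

primrec sat :: "('s list set \<Rightarrow> 'u list set) \<Rightarrow> 's form \<Rightarrow> (nat \<Rightarrow> 'u) \<Rightarrow> bool" where
  "sat I (Rel R is) e \<longleftrightarrow> map e is \<in> I R"
| "sat I (Eq i j) e \<longleftrightarrow> e i = e j"
| "sat I (Neg \<phi>) e \<longleftrightarrow> \<not> sat I \<phi> e"
| "sat I (Conj \<phi> \<psi>) e \<longleftrightarrow> sat I \<phi> e \<and> sat I \<psi> e"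
| "sat I (Forall i \<phi>) e \<longleftrightarrow> (\<forall>u. sat I \<phi> (e(i := u)))"

text \<open>
  The standard universe is \<open>'x + real\<close>, where the metric space will be a subset of \<open>'x\<close>; since
  \<open>'x\<close> is arbitrary, it may also contain further standard objects such as sets, functions or
  any finite levels of a superstructure. The nonstandard universe is \<open>'y + 'r\<close>, where \<open>'r\<close> is
  the field of nonstandard reals. The extension is given by the map \<open>star\<close>, sending each
  standard relation \<open>R\<close> to \<open>*R\<close>.
\<close>

type_synonym ('x, 'y, 'r) star_map = "('x + real) list set \<Rightarrow> ('y + 'r) list set"

definition star_elem :: "('x, 'y, 'r) star_map \<Rightarrow> 'x + real \<Rightarrow> 'y + 'r" where
  "star_elem star s = (THE t. [t] \<in> star {[s]})"

definition transfer_principle :: "('x, 'y, 'r) star_map \<Rightarrow> bool" where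
  "transfer_principle star \<longleftrightarrow>
     (\<forall>\<phi> e. sat (\<lambda>R. R) \<phi> e \<longleftrightarrow> sat star \<phi> (\<lambda>i. star_elem star (e i)))"

text \<open>
  A saturation property that follows from countable saturation as well as from the enlargement
  property: countably many standard sets with the finite intersection property have
  nonstandard extensions with a common element.
\<close>

definition saturated :: "('x, 'y, 'r) star_map \<Rightarrow> bool" where
  "saturated star \<longleftrightarrow>
     (\<forall>A :: nat \<Rightarrow> ('x + real) set. (\<forall>n. (\<Inter>k\<le>n. A k) \<noteq> {}) \<longrightarrow>
        (\<exists>t. \<forall>n. [t] \<in> star {[s] | s. s \<in> A n}))"

text \<open>
  The last four conditions say that the right summand \<open>'r\<close> is the nonstandard extension of the
  set of reals and that its operations and order are the extensions of the real ones.
\<close>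

definition nonstandard_model ::
    "('x, 'y, 'r::linordered_field) star_map \<Rightarrow> bool" where
  "nonstandard_model star \<longleftrightarrow>
     transfer_principle star \<and> saturated star \<and>
     (\<forall>t. [t] \<in> star {[Inr x] | x. True} \<longleftrightarrow> (\<exists>a. t = Inr a)) \<and>
     (\<forall>a b c. [Inr a, Inr b, Inr c] \<in> star {[Inr x, Inr y, Inr (x + y)] | x y. True}
        \<longleftrightarrow> c = a + b) \<and>
     (\<forall>a b c. [Inr a, Inr b, Inr c] \<in> star {[Inr x, Inr y, Inr (x * y)] | x y. True}
        \<longleftrightarrow> c = a * b) \<and>
     (\<forall>a b. [Inr a, Inr b] \<in> star {[Inr x, Inr y] | x y. x < y} \<longleftrightarrow> a < b)"

definition star_real :: "('x, 'y, 'r) star_map \<Rightarrow> real \<Rightarrow> 'r" where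
  "star_real star r = (THE a. star_elem star (Inr r) = Inr a)"

definition star_set :: "('x, 'y, 'r) star_map \<Rightarrow> 'x set \<Rightarrow> 'y set" where
  "star_set star M = {\<xi>. [Inl \<xi>] \<in> star {[Inl x] | x. x \<in> M}}"

definition star_dist ::
    "('x, 'y, 'r) star_map \<Rightarrow> 'x set \<Rightarrow> ('x \<Rightarrow> 'x \<Rightarrow> real) \<Rightarrow> 'y \<Rightarrow> 'y \<Rightarrow> 'r" where
  "star_dist star M d \<xi> \<eta> =
     (THE a. [Inl \<xi>, Inl \<eta>, Inr a] \<in>
        star {[Inl x, Inl y, Inr (d x y)] | x y. x \<in> M \<and> y \<in> M})"


section \<open>Orders of magnitude and galaxies\<close>

definition infinitely_small :: "'r::linordered_field \<Rightarrow> bool" where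
  "infinitely_small s \<longleftrightarrow> (\<forall>n::nat. n \<ge> 1 \<longrightarrow> \<bar>s\<bar> < 1 / of_nat n)"

definition infinitely_large :: "'r::linordered_field \<Rightarrow> bool" where
  "infinitely_large s \<longleftrightarrow> (\<forall>n::nat. \<bar>s\<bar> > of_nat n)"

definition limited :: "'r::linordered_field \<Rightarrow> bool" where
  "limited s \<longleftrightarrow> \<not> infinitely_large s"

lemma limited_iff: "limited s \<longleftrightarrow> (\<exists>n::nat. \<bar>s\<bar> \<le> of_nat n)"
  by (simp add: limited_def infinitely_large_def not_less)

lemma limited_0 [simp]: "limited 0"
  by (simp add: limited_iff)

lemma limited_add: "limited s \<Longrightarrow> limited t \<Longrightarrow> limited (s + t)"
  unfolding limited_iff
  by (metis (no_types, lifting) abs_triangle_ineq add_mono of_nat_add order_trans)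

lemma limited_minus [simp]: "limited (- s) \<longleftrightarrow> limited s"
  by (simp add: limited_iff)

lemma limited_minus_commute: "limited (s - t) \<longleftrightarrow> limited (t - s)"
  by (simp add: limited_iff abs_minus_commute)

lemma limited_squeeze: "0 \<le> s \<Longrightarrow> s \<le> t \<Longrightarrow> limited t \<Longrightarrow> limited s"
  unfolding limited_iff by (metis abs_of_nonneg order_trans)

quotient_type (overloaded) 'r gal = "'r::linordered_field" / "\<lambda>s t. limited (s - t)"
  morphisms rep_Gal Gal
proof (rule equivpI)
  show "reflp (\<lambda>s t::'r. limited (s - t))"
    by (simp add: reflp_def)
  show "symp (\<lambda>s t::'r. limited (s - t))"
    by (simp add: symp_def limited_minus_commute)
  show "transp (\<lambda>s t::'r. limited (s - t))"
    using limited_add by (fastforce simp: transp_def)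
qed

instantiation gal :: (linordered_field) linordered_ab_group_add
begin

lift_definition zero_gal :: "'a gal" is 0 .

lift_definition plus_gal :: "'a gal \<Rightarrow> 'a gal \<Rightarrow> 'a gal" is "(+)"
  using limited_add by (fastforce simp: algebra_simps)

lift_definition uminus_gal :: "'a gal \<Rightarrow> 'a gal" is "uminus"
  by (simp add: limited_minus_commute)

lift_definition minus_gal :: "'a gal \<Rightarrow> 'a gal \<Rightarrow> 'a gal" is "(-)"
proof -
  fix a b c e :: 'a
  assume "limited (a - b)" "limited (c - e)"
  then have "limited ((a - b) + (e - c))"
    by (intro limited_add) (simp_all add: limited_minus_commute)
  then show "limited (a - c - (b - e))"
    by (simp add: algebra_simps)
qed

lift_definition less_eq_gal :: "'a gal \<Rightarrow> 'a gal \<Rightarrow> bool"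
  is "\<lambda>s t. s \<le> t \<or> limited (s - t)"
proof -
  have *: "c \<le> e \<or> limited (c - e)"
    if "limited (a - c)" "limited (b - e)" "a \<le> b \<or> limited (a - b)" for a b c e :: 'a
  proof (cases "c \<le> e")
    case False
    have 1: "limited (c - a)" using that(1) by (simp add: limited_minus_commute)
    show ?thesis
    proof (cases "limited (a - b)")
      case True
      have "limited ((c - a) + (a - b) + (b - e))"
        using 1 True that(2) by (intro limited_add)
      then show ?thesis by (simp add: algebra_simps)
    next
      case 2: False
      then have "a \<le> b" using that(3) by blast
      then have "c - e \<le> (c - a) + (b - e)" by simp
      moreover have "limited ((c - a) + (b - e))"
        using 1 that(2) by (intro limited_add)
      ultimately have "limited (c - e)"
        using False limited_squeeze[of "c - e" "(c - a) + (b - e)"] by simp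
      then show ?thesis ..
    qed
  qed simp
  fix a b c e :: 'a
  assume "limited (a - b)" "limited (c - e)"
  then show "(a \<le> c \<or> limited (a - c)) = (b \<le> e \<or> limited (b - e))"
    using *[of a b c e] *[of b a e c] by (auto simp: limited_minus_commute)
qed

definition less_gal :: "'a gal \<Rightarrow> 'a gal \<Rightarrow> bool" where
  "less_gal x y \<longleftrightarrow> x \<le> y \<and> \<not> y \<le> x"

instance
proof
  fix x y z :: "'a gal"
  show "x + y + z = x + (y + z)" by transfer (simp add: algebra_simps)
  show "x + y = y + x" by transfer (simp add: algebra_simps)
  show "0 + x = x" by transfer simp
  show "- x + x = 0" by transfer simp
  show "x - y = x + - y" by transfer simp
  show "x < y \<longleftrightarrow> x \<le> y \<and> \<not> y \<le> x" by (rule less_gal_def)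
  show "x \<le> x" by transfer simp
  show "x \<le> z" if "x \<le> y" "y \<le> z"
    using that
  proof transfer
    fix x y z :: 'a
    assume xy: "x \<le> y \<or> limited (x - y)" and yz: "y \<le> z \<or> limited (y - z)"
    show "x \<le> z \<or> limited (x - z)"
    proof (cases "x \<le> z")
      case False
      have "limited (x - z)"
      proof (cases "limited (x - y)")
        case 1: True
        show ?thesis
        proof (cases "limited (y - z)")
          case True
          then show ?thesis using limited_add[OF 1] by fastforce
        next
          case 2: False
          then show ?thesis using yz False limited_squeeze[OF _ _ 1, of "x - z"] by auto
        qed
      next
        case 1: False
        then have "x \<le> y" "limited (y - z)" using xy yz False by auto
        then show ?thesis using False limited_squeeze[of "x - z" "y - z"] by auto
      qed
      then show ?thesis ..
    qed simp
  qed
  show "x = y" if "x \<le> y" "y \<le> x"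
    using that by transfer (auto simp: limited_minus_commute)
  show "x \<le> y \<or> y \<le> x" by transfer auto
  show "z + x \<le> z + y" if "x \<le> y" using that by transfer simp
qed

end

text \<open>The element \<open>\<gamma> \<bullet> \<tau>\<close>, well defined for limited \<open>\<gamma> > 0\<close>.\<close>

definition gal_scale :: "'r::linordered_field \<Rightarrow> 'r gal \<Rightarrow> 'r gal" where
  "gal_scale \<gamma> \<tau> = (THE \<sigma>. \<forall>t. Gal t = \<tau> \<longrightarrow> \<sigma> = Gal (\<gamma> * t))"

definition st :: "('x, 'y, 'r::linordered_field) star_map \<Rightarrow> 'r \<Rightarrow> real extended" where
  "st star s =
     (if limited s then Fin (THE r. infinitely_small (s - star_real star r))
      else if s > 0 then Pinf else Minf)"


section \<open>Generalized galactic spaces\<close>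

text \<open>
  The value \<open>Minf\<close> of the type \<open>_ extended\<close> is excluded by the general metric rule, which
  forces all distances to be nonnegative.
\<close>

definition metric_rule :: "'a set \<Rightarrow> ('a \<Rightarrow> 'a \<Rightarrow> 'v::{zero,plus,order}) \<Rightarrow> bool" where
  "metric_rule Y d \<longleftrightarrow>
     (\<forall>x\<in>Y. d x x = 0) \<and>
     (\<forall>x\<in>Y. \<forall>y\<in>Y. x \<noteq> y \<longrightarrow> d x y = d y x \<and> d y x > 0) \<and>
     (\<forall>x\<in>Y. \<forall>y\<in>Y. \<forall>z\<in>Y. d x z \<le> d x y + d y z)"

type_synonym ('a, 'r) space =
  "'a set \<times> ('a \<Rightarrow> 'a \<Rightarrow> real extended) \<times> ('a set \<Rightarrow> 'a set \<Rightarrow> 'r gal extended)"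

abbreviation points :: "('a, 'r::linordered_field) space \<Rightarrow> 'a set" where
  "points S \<equiv> fst S"

abbreviation small_dist ::
    "('a, 'r::linordered_field) space \<Rightarrow> 'a \<Rightarrow> 'a \<Rightarrow> real extended" where
  "small_dist S \<equiv> fst (snd S)"

abbreviation large_dist ::
    "('a, 'r::linordered_field) space \<Rightarrow> 'a set \<Rightarrow> 'a set \<Rightarrow> 'r gal extended" where
  "large_dist S \<equiv> snd (snd S)"

definition components :: "'a set \<Rightarrow> ('a \<Rightarrow> 'a \<Rightarrow> real extended) \<Rightarrow> 'a set set" where
  "components F \<delta> = F // {(x, y). x \<in> F \<and> y \<in> F \<and> \<delta> x y < Pinf}"

abbreviation comps :: "('a, 'r::linordered_field) space \<Rightarrow> 'a set set" where
  "comps S \<equiv> components (points S) (small_dist S)"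

definition generalized_galactic :: "('a, 'r::linordered_field) space \<Rightarrow> bool" where
  "generalized_galactic S \<longleftrightarrow>
     metric_rule (points S) (small_dist S) \<and> metric_rule (comps S) (large_dist S)"

definition induced ::
    "('a, 'r::linordered_field) space \<Rightarrow> ('b, 'r) space \<Rightarrow> ('a \<Rightarrow> 'b) \<Rightarrow> 'a set \<Rightarrow> 'b set" where
  "induced S S' f E = (THE E'. E' \<in> comps S' \<and> f ` E \<subseteq> E')"

text \<open>
  The parameter \<open>\<iota>\<close> is the embedding of the reals into \<open>'r\<close>; the first inequality is one in
  \<open>'r \<union> {+\<infinity>}\<close>. Maps are taken extensional, so that equality of morphisms is equality of
  functions.
\<close>

definition morphism ::
    "(real \<Rightarrow> 'r::linordered_field) \<Rightarrow> ('a, 'r) space \<Rightarrow> ('b, 'r) space \<Rightarrow> ('a \<Rightarrow> 'b) \<Rightarrow> bool"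
  where
  "morphism \<iota> S S' f \<longleftrightarrow>
     f \<in> points S \<rightarrow>\<^sub>E points S' \<and>
     (\<exists>\<gamma>. limited \<gamma> \<and> \<gamma> > 0 \<and>
        (\<forall>x\<^sub>1\<in>points S. \<forall>x\<^sub>2\<in>points S.
           map_extended \<iota> (small_dist S' (f x\<^sub>1) (f x\<^sub>2))
             \<le> map_extended (\<lambda>s. \<gamma> * \<iota> s) (small_dist S x\<^sub>1 x\<^sub>2)) \<and>
        (\<forall>E\<^sub>1\<in>comps S. \<forall>E\<^sub>2\<in>comps S.
           large_dist S' (induced S S' f E\<^sub>1) (induced S S' f E\<^sub>2)
             \<le> map_extended (gal_scale \<gamma>) (large_dist S E\<^sub>1 E\<^sub>2)))"


section \<open>Inverse limits of generalized galactic spaces\<close>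

definition inverse_system ::
    "(real \<Rightarrow> 'r::linordered_field) \<Rightarrow> 'i::order set \<Rightarrow> ('i \<Rightarrow> ('a, 'r) space)
      \<Rightarrow> ('i \<Rightarrow> 'i \<Rightarrow> 'a \<Rightarrow> 'a) \<Rightarrow> bool" where
  "inverse_system \<iota> I S p \<longleftrightarrow>
     I \<noteq> {} \<and> (\<forall>\<alpha>\<in>I. \<forall>\<beta>\<in>I. \<exists>\<gamma>\<in>I. \<alpha> \<le> \<gamma> \<and> \<beta> \<le> \<gamma>) \<and>
     (\<forall>\<alpha>\<in>I. generalized_galactic (S \<alpha>)) \<and>
     (\<forall>\<alpha>\<in>I. \<forall>\<beta>\<in>I. \<beta> \<le> \<alpha> \<longrightarrow> morphism \<iota> (S \<alpha>) (S \<beta>) (p \<beta> \<alpha>)) \<and>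
     (\<forall>\<alpha>\<in>I. \<forall>x\<in>points (S \<alpha>). p \<alpha> \<alpha> x = x) \<and>
     (\<forall>\<alpha>\<in>I. \<forall>\<beta>\<in>I. \<forall>\<gamma>\<in>I. \<gamma> \<le> \<beta> \<and> \<beta> \<le> \<alpha> \<longrightarrow>
        (\<forall>x\<in>points (S \<alpha>). p \<gamma> \<beta> (p \<beta> \<alpha> x) = p \<gamma> \<alpha> x))"

definition cone ::
    "(real \<Rightarrow> 'r::linordered_field) \<Rightarrow> 'i::order set \<Rightarrow> ('i \<Rightarrow> ('a, 'r) space)
      \<Rightarrow> ('i \<Rightarrow> 'i \<Rightarrow> 'a \<Rightarrow> 'a) \<Rightarrow> ('b, 'r) space \<Rightarrow> ('i \<Rightarrow> 'b \<Rightarrow> 'a) \<Rightarrow> bool" where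
  "cone \<iota> I S p L q \<longleftrightarrow>
     generalized_galactic L \<and>
     (\<forall>\<alpha>\<in>I. morphism \<iota> L (S \<alpha>) (q \<alpha>)) \<and>
     (\<forall>\<alpha>\<in>I. \<forall>\<beta>\<in>I. \<beta> \<le> \<alpha> \<longrightarrow> (\<forall>x\<in>points L. p \<beta> \<alpha> (q \<alpha> x) = q \<beta> x))"

text \<open>
  The universal property is stated for test objects whose points have type \<open>'f\<close>; a theorem
  in which \<open>'f\<close> is a free type variable covers all test objects.
\<close>

definition inverse_limit ::
    "'f itself \<Rightarrow> (real \<Rightarrow> 'r::linordered_field) \<Rightarrow> 'i::order set \<Rightarrow> ('i \<Rightarrow> ('a, 'r) space)
      \<Rightarrow> ('i \<Rightarrow> 'i \<Rightarrow> 'a \<Rightarrow> 'a) \<Rightarrow> ('b, 'r) space \<Rightarrow> ('i \<Rightarrow> 'b \<Rightarrow> 'a) \<Rightarrow> bool" where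
  "inverse_limit T \<iota> I S p L q \<longleftrightarrow>
     inverse_system \<iota> I S p \<and> cone \<iota> I S p L q \<and>
     (\<forall>(K :: ('f, 'r) space) g. cone \<iota> I S p K g \<longrightarrow>
        (\<exists>!h. morphism \<iota> K L h \<and> (\<forall>\<alpha>\<in>I. \<forall>x\<in>points K. q \<alpha> (h x) = g \<alpha> x)))"


section \<open>The scalings of a metric space and their limit\<close>

definition scales :: "'r::linordered_field set" where
  "scales = {\<alpha>. \<alpha> > 0}"

context
  fixes star :: "('x, 'y, 'r::linordered_field) star_map"
    and M :: "'x set" and d :: "'x \<Rightarrow> 'x \<Rightarrow> real"
begin

definition near_rel :: "'r \<Rightarrow> ('y \<times> 'y) set" where
  "near_rel \<alpha> = {(x, y). x \<in> star_set star M \<and> y \<in> star_set star M \<and>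
     infinitely_small (\<alpha> * star_dist star M d x y)}"

definition scaled_points :: "'r \<Rightarrow> 'y set set" where
  "scaled_points \<alpha> = star_set star M // near_rel \<alpha>"

definition scaling_proj :: "'r \<Rightarrow> 'y \<Rightarrow> 'y set" where
  "scaling_proj \<alpha> x = near_rel \<alpha> `` {x}"

definition scaled_delta :: "'r \<Rightarrow> 'y set \<Rightarrow> 'y set \<Rightarrow> real extended" where
  "scaled_delta \<alpha> \<xi> \<eta> =
     (THE v. \<forall>x\<in>star_set star M. \<forall>y\<in>star_set star M.
        scaling_proj \<alpha> x = \<xi> \<and> scaling_proj \<alpha> y = \<eta> \<longrightarrow> v = st star (\<alpha> * star_dist star M d x y))"

definition scaled_Delta :: "'r \<Rightarrow> 'y set set \<Rightarrow> 'y set set \<Rightarrow> 'r gal" where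
  "scaled_Delta \<alpha> E\<^sub>1 E\<^sub>2 =
     (THE v. \<forall>x\<^sub>1\<in>star_set star M. \<forall>x\<^sub>2\<in>star_set star M.
        scaling_proj \<alpha> x\<^sub>1 \<in> E\<^sub>1 \<and> scaling_proj \<alpha> x\<^sub>2 \<in> E\<^sub>2 \<longrightarrow>
          v = Gal (\<alpha> * star_dist star M d x\<^sub>1 x\<^sub>2))"

definition scaling :: "'r \<Rightarrow> ('y set, 'r) space" where
  "scaling \<alpha> =
     (scaled_points \<alpha>, scaled_delta \<alpha>, \<lambda>E\<^sub>1 E\<^sub>2. Fin (scaled_Delta \<alpha> E\<^sub>1 E\<^sub>2))"

definition scaling_map :: "'r \<Rightarrow> 'r \<Rightarrow> 'y set \<Rightarrow> 'y set" where
  "scaling_map \<beta> \<alpha> =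
     (THE p. p \<in> scaled_points \<alpha> \<rightarrow>\<^sub>E scaled_points \<beta> \<and>
        (\<forall>x\<in>star_set star M. scaling_proj \<beta> x = p (scaling_proj \<alpha> x)))"

definition limit_points :: "('r \<Rightarrow> 'y set) set" where
  "limit_points =
     {\<xi> \<in> Pi\<^sub>E scales scaled_points.
        \<forall>\<alpha>\<in>scales. \<forall>\<beta>\<in>scales. \<beta> \<le> \<alpha> \<longrightarrow> scaling_map \<beta> \<alpha> (\<xi> \<alpha>) = \<xi> \<beta>}"

text \<open>
  All metric components of the limit are singletons, so it suffices to compare them as sets in
  the last component.
\<close>

definition limit_space :: "('r \<Rightarrow> 'y set, 'r) space" where
  "limit_space =
     (limit_points,
      \<lambda>\<xi> \<eta>. if \<xi> = \<eta> then 0 else Pinf,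
      \<lambda>E\<^sub>1 E\<^sub>2. if E\<^sub>1 = E\<^sub>2 then 0 else Pinf)"

definition limit_map :: "'r \<Rightarrow> ('r \<Rightarrow> 'y set) \<Rightarrow> 'y set" where
  "limit_map \<alpha> = (\<lambda>\<xi>\<in>limit_points. \<xi> \<alpha>)"

end

end

theory Submission
  imports Defs
begin

text \<open>
  Transfer makes \<open>*d\<close> a pseudometric with values in \<open>*\<real>\<close>, and standard parts and galaxies turn
  it into the distances of the scalings. The main point is that a cone \<open>g\<close> over the scalings
  identifies any two points \<open>u\<close>, \<open>v\<close> at finite large distance \<open>Gal t\<close> from each other. If \<open>g \<alpha>'\<close>
  sends them to the classes of \<open>x\<close> and \<open>y\<close>, then \<open>\<alpha>' *d(x, y)\<close> is at most a limited multiple of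
  \<open>\<bar>t\<bar> + 1\<close>. Choosing \<open>\<alpha>'\<close> larger than \<open>\<alpha> (\<bar>t\<bar> + 1)\<close> by an infinitely large factor makes
  \<open>\<alpha> *d(x, y)\<close> infinitely small. Therefore every cone factors through the discrete space of
  coherent families.
\<close>

section \<open>Transfer\<close>

abbreviation Imp :: "'s form \<Rightarrow> 's form \<Rightarrow> 's form" where
  "Imp \<phi> \<psi> \<equiv> Neg (Conj \<phi> (Neg \<psi>))"

text \<open>Names for the comprehensions that occur in \<open>nonstandard_model\<close>,
  \<open>star_set\<close> and \<open>star_dist\<close>. Inside a formula they stay folded, and
  \<open>rel_defs\<close> opens them when its standard truth is checked.\<close>

definition real_rel :: "('x + real) list set" where
  "real_rel = {[Inr x] | x. True}"

definition add_rel :: "('x + real) list set" where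
  "add_rel = {[Inr x, Inr y, Inr (x + y)] | x y. True}"

definition mult_rel :: "('x + real) list set" where
  "mult_rel = {[Inr x, Inr y, Inr (x * y)] | x y. True}"

definition less_rel :: "('x + real) list set" where
  "less_rel = {[Inr x, Inr y] | x y. x < y}"

definition point_rel :: "'x set \<Rightarrow> ('x + real) list set" where
  "point_rel M = {[Inl x] | x. x \<in> M}"

definition dist_rel :: "'x set \<Rightarrow> ('x \<Rightarrow> 'x \<Rightarrow> real) \<Rightarrow> ('x + real) list set" where
  "dist_rel M d = {[Inl x, Inl y, Inr (d x y)] | x y. x \<in> M \<and> y \<in> M}"

lemmas rel_defs = real_rel_def add_rel_def mult_rel_def less_rel_def point_rel_def dist_rel_def

section \<open>The standard reals inside the nonstandard field\<close>

locale nonstandard_extension =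
  fixes star :: "('x, 'y, 'r::linordered_field) star_map"
  assumes model: "nonstandard_model star"
begin

lemma transfer: "sat (\<lambda>R. R) \<phi> e \<Longrightarrow> sat star \<phi> (\<lambda>i. star_elem star (e i))"
  using model by (simp add: nonstandard_model_def transfer_principle_def)

lemma star_real_universe: "[t] \<in> star real_rel \<longleftrightarrow> (\<exists>a. t = Inr a)"
  using model by (simp add: nonstandard_model_def rel_defs)

lemma star_add: "[Inr a, Inr b, Inr c] \<in> star add_rel
    \<longleftrightarrow> c = a + b"
  using model by (simp add: nonstandard_model_def rel_defs)

lemma star_mult: "[Inr a, Inr b, Inr c] \<in> star mult_rel
    \<longleftrightarrow> c = a * b"
  using model by (simp add: nonstandard_model_def rel_defs)

lemma star_less: "[Inr a, Inr b] \<in> star less_rel \<longleftrightarrow> a < b"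
  using model by (simp add: nonstandard_model_def rel_defs)

text \<open>Membership in the set of reals transfers, and the model identifies the extension of that
  set with the right summand. This makes the \<open>THE\<close> in \<open>star_real\<close> well
  determined.\<close>

lemma star_elem_Inr: "star_elem star (Inr r) = Inr (star_real star r)"
proof -
  have "sat star (Rel real_rel [0]) (\<lambda>i. star_elem star (Inr r))"
    by (rule transfer) (auto simp: rel_defs)
  then obtain a where "star_elem star (Inr r) = Inr a"
    using star_real_universe by auto
  then show ?thesis
    by (simp add: star_real_def)
qed

text \<open>The formula has no quantifier; its valuation supplies \<open>x\<close>, \<open>y\<close>
  and \<open>x + y\<close> for the variables 0, 1 and 2, and \<open>star_add\<close> reads the
  transferred membership as addition in the field.\<close>

lemma star_real_add: "star_real star (x + y) = star_real star x + star_real star y"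
proof -
  have "sat star (Rel add_rel [0, 1, 2])
      (\<lambda>i. star_elem star ((\<lambda>i::nat. if i = 0 then Inr x else if i = 1 then Inr y else Inr (x + y)) i))"
    by (rule transfer) (auto simp: rel_defs)
  then show ?thesis
    by (simp add: star_elem_Inr star_add)
qed

lemma star_real_mult: "star_real star (x * y) = star_real star x * star_real star y"
proof -
  have "sat star (Rel mult_rel [0, 1, 2])
      (\<lambda>i. star_elem star ((\<lambda>i::nat. if i = 0 then Inr x else if i = 1 then Inr y else Inr (x * y)) i))"
    by (rule transfer) (auto simp: rel_defs)
  then show ?thesis
    by (simp add: star_elem_Inr star_mult)
qed

lemma star_real_strict_mono:
  assumes "x < y" shows "star_real star x < star_real star y"
proof -
  have "sat star (Rel less_rel [0, 1])
      (\<lambda>i. star_elem star ((\<lambda>i::nat. if i = 0 then Inr x else Inr y) i))"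
    by (rule transfer) (use assms in \<open>auto simp: rel_defs\<close>)
  then show ?thesis
    by (simp add: star_elem_Inr star_less)
qed

lemma star_real_less [simp]: "star_real star x < star_real star y \<longleftrightarrow> x < y"
  by (metis star_real_strict_mono less_asym linorder_neqE_linordered_idom)

lemma star_real_le [simp]: "star_real star x \<le> star_real star y \<longleftrightarrow> x \<le> y"
  by (meson linorder_not_less star_real_less)

lemma star_real_0 [simp]: "star_real star 0 = 0"
  using star_real_add[of 0 0] by simp

text \<open>The image of 1 is idempotent, hence 0 or 1, and strict monotonicity excludes 0.\<close>

lemma star_real_1 [simp]: "star_real star 1 = 1"
  using star_real_mult[of 1 1] star_real_strict_mono[of 0 1] by simp

lemma star_real_minus: "star_real star (- x) = - star_real star x"
  using star_real_add[of x "- x"] by (simp add: eq_neg_iff_add_eq_0 add.commute)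

lemma star_real_diff: "star_real star (x - y) = star_real star x - star_real star y"
  using star_real_add[of x "- y"] by (simp add: star_real_minus)

lemma star_real_of_nat [simp]: "star_real star (real n) = of_nat n"
  by (induction n) (simp_all add: star_real_add)

lemma star_real_inverse_of_nat [simp]: "star_real star (1 / real n) = 1 / of_nat n"
\<comment> \<open>At \<open>n = 0\<close> both quotients are 0, the default value of division by
  zero.\<close>
proof (cases "n = 0")
  case False
  have "star_real star (1 / real n) * star_real star (real n) = 1"
    using False by (simp flip: star_real_mult del: star_real_of_nat)
  then show ?thesis
    using False by (simp add: field_simps)
qed simp

text \<open>Saturation enters here: the sets of reals above \<open>n\<close> have the finite
  intersection property, and a common element of their extensions exceeds every standard natural
  number. It supplies the infinitely large factor in \<open>cone_collapse\<close>.\<close>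

lemma unlimited_exists: obtains \<omega> :: 'r where "\<And>n::nat. of_nat n < \<omega>"
proof -
  define A :: "nat \<Rightarrow> ('x + real) set" where "A n = {Inr x | x. x > real n}" for n
  have "Inr (real n + 1) \<in> (\<Inter>k\<le>n. A k)" for n
    by (auto simp: A_def)
  then have "\<forall>n. (\<Inter>k\<le>n. A k) \<noteq> {}"
    by blast
  then obtain t where t: "[t] \<in> star {[s] | s. s \<in> A n}" for n
    using model unfolding nonstandard_model_def saturated_def by blast
  \<comment> \<open>Saturation yields only an element of the whole nonstandard universe; since
    \<open>A 0\<close> consists of reals, transfer places \<open>t\<close> in the right
    summand.\<close>
  have "sat star (Forall 0 (Imp (Rel {[s] | s. s \<in> A 0} [0]) (Rel real_rel [0])))
      (\<lambda>i. star_elem star (Inr 0))"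
    by (rule transfer) (auto simp: rel_defs A_def)
  then obtain \<omega> where \<omega>: "t = Inr \<omega>"
    using t star_real_universe by auto
  have "of_nat n < \<omega>" for n
  proof -
    \<comment> \<open>Variable 1 is free here and stands for the standard real
      \<open>n\<close>.\<close>
    have "sat star (Forall 0 (Imp (Rel {[s] | s. s \<in> A n} [0])
        (Rel less_rel [1, 0]))) (\<lambda>i. star_elem star (Inr (real n)))"
      by (rule transfer) (auto simp: rel_defs A_def)
    then have "[Inr (of_nat n), t] \<in> star less_rel"
      using t[of n] by (auto simp: star_elem_Inr)
    then show ?thesis
      by (simp add: \<omega> star_less)
  qed
  then show thesis
    using that by blast
qed

end

section \<open>The nonstandard extension of the distance\<close>

locale nonstandard_metric = nonstandard_extension star + Metric_space M d
  for star :: "('x, 'y, 'r::linordered_field) star_map" and M :: "'x set" and d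
begin

abbreviation "starM \<equiv> star_set star M"

abbreviation "stard \<equiv> star_dist star M d"

lemma star_dist_unique:
  assumes "[Inl u, Inl v, Inr a] \<in> star (dist_rel M d)" "[Inl u, Inl v, Inr b] \<in> star (dist_rel M d)"
  shows "a = b"
proof -
  have "sat star (Forall 0 (Forall 1 (Forall 2 (Forall 3 (Imp
      (Conj (Rel (dist_rel M d) [0, 1, 2]) (Rel (dist_rel M d) [0, 1, 3])) (Eq 2 3))))))
      (\<lambda>i. star_elem star (Inr 0))"
    by (rule transfer) (auto simp: rel_defs)
  then have "\<forall>u v a b. [u, v, a] \<in> star (dist_rel M d) \<and> [u, v, b] \<in> star (dist_rel M d) \<longrightarrow> a = b"
    by (simp add: numeral_eq_Suc) blast
  then show ?thesis
    using assms by blast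
qed

text \<open>Transfers the existence of a distance for any two points, written as a negated
  universal, together with the fact that it is real. The latter makes the value an
  \<open>Inr\<close>, and \<open>star_dist_unique\<close> then identifies it with the
  \<open>THE\<close> in \<open>star_dist\<close>.\<close>

lemma star_dist_graph:
  assumes "u \<in> starM" "v \<in> starM"
  shows "[Inl u, Inl v, Inr (stard u v)] \<in> star (dist_rel M d)"
proof -
  have "sat star (Forall 0 (Forall 1 (Imp
      (Conj (Rel (point_rel M) [0]) (Rel (point_rel M) [1]))
      (Neg (Forall 2 (Neg (Conj (Rel (dist_rel M d) [0, 1, 2]) (Rel real_rel [2]))))))))
      (\<lambda>i. star_elem star (Inr 0))"
    by (rule transfer) (auto simp: rel_defs)
  then have "\<forall>u v. [u] \<in> star (point_rel M) \<and> [v] \<in> star (point_rel M) \<longrightarrow>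
      (\<exists>w. [u, v, w] \<in> star (dist_rel M d) \<and> [w] \<in> star real_rel)"
    by (simp add: numeral_eq_Suc)
  then obtain w where w: "[Inl u, Inl v, w] \<in> star (dist_rel M d)" "[w] \<in> star real_rel"
    using assms unfolding star_set_def point_rel_def by blast
  then obtain a where "w = Inr a"
    using star_real_universe by blast
  then have "[Inl u, Inl v, Inr a] \<in> star (dist_rel M d)"
    using w by simp
  then show ?thesis
    unfolding star_dist_def dist_rel_def[symmetric]
    by (rule theI) (rule star_dist_unique[OF _ \<open>[Inl u, Inl v, Inr a] \<in> _\<close>])
qed

lemma star_dist_refl:
  assumes "u \<in> starM" shows "stard u u = 0"
proof -
  \<comment> \<open>Variable 3 is left free, so that the valuation makes it a name for the real
    0.\<close>
  have "sat star (Forall 0 (Forall 2 (Imp (Rel (dist_rel M d) [0, 0, 2]) (Eq 2 3))))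
      (\<lambda>i. star_elem star (Inr 0))"
    by (rule transfer) (auto simp: rel_defs)
  then have "\<forall>u a. [u, u, a] \<in> star (dist_rel M d) \<longrightarrow> a = Inr 0"
    by (simp add: star_elem_Inr numeral_eq_Suc)
  then show ?thesis
    using star_dist_graph[OF assms assms] by blast
qed

lemma star_dist_commute:
  assumes "u \<in> starM" "v \<in> starM" shows "stard u v = stard v u"
proof -
  have "sat star (Forall 0 (Forall 1 (Forall 2
      (Imp (Rel (dist_rel M d) [0, 1, 2]) (Rel (dist_rel M d) [1, 0, 2])))))
      (\<lambda>i. star_elem star (Inr 0))"
    by (rule transfer) (auto simp: rel_defs commute)
  then have "\<forall>u v a. [u, v, a] \<in> star (dist_rel M d) \<longrightarrow> [v, u, a] \<in> star (dist_rel M d)"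
    by (simp add: numeral_eq_Suc)
  then show ?thesis
    using star_dist_graph assms star_dist_unique by blast
qed

lemma star_dist_nonneg:
  assumes "u \<in> starM" "v \<in> starM" shows "0 \<le> stard u v"
proof -
  have "sat star (Forall 0 (Forall 1 (Forall 2
      (Imp (Rel (dist_rel M d) [0, 1, 2]) (Neg (Rel less_rel [2, 3]))))))
      (\<lambda>i. star_elem star (Inr 0))"
    by (rule transfer) (auto simp: rel_defs not_less)
  then have "\<forall>u v a. [u, v, a] \<in> star (dist_rel M d) \<longrightarrow> [a, Inr 0] \<notin> star less_rel"
    by (simp add: star_elem_Inr numeral_eq_Suc)
  then show ?thesis
    using star_dist_graph[OF assms] star_less by (metis not_less)
qed

lemma star_dist_triangle:
  assumes "u \<in> starM" "v \<in> starM" "w \<in> starM"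
  shows "stard u w \<le> stard u v + stard v w"
proof -
  \<comment> \<open>The language has relation symbols but no terms, so the sum of the two distances
    needs a variable of its own, number 6, tied to them by \<open>add_rel\<close>. The inequality is
    expressed as the failure of its strict converse.\<close>
  have "sat star (Forall 0 (Forall 1 (Forall 2 (Forall 3 (Forall 4 (Forall 5 (Forall 6
      (Imp (Conj (Rel (dist_rel M d) [0, 1, 3]) (Conj (Rel (dist_rel M d) [1, 2, 4])
        (Conj (Rel (dist_rel M d) [0, 2, 5]) (Rel add_rel [3, 4, 6]))))
      (Neg (Rel less_rel [6, 5]))))))))))
      (\<lambda>i. star_elem star (Inr 0))"
    by (rule transfer) (auto simp: rel_defs not_less triangle)
  then have "\<forall>u v w a b c s. [u, v, a] \<in> star (dist_rel M d) \<and> [v, w, b] \<in> star (dist_rel M d) \<and>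
      [u, w, c] \<in> star (dist_rel M d) \<and> [a, b, s] \<in> star add_rel \<longrightarrow> [s, c] \<notin> star less_rel"
    by (simp add: numeral_eq_Suc) blast
  moreover have "[Inr (stard u v), Inr (stard v w), Inr (stard u v + stard v w)] \<in> star add_rel"
    by (simp add: star_add)
  ultimately have "[Inr (stard u v + stard v w), Inr (stard u w)] \<notin> star less_rel"
    using star_dist_graph assms by blast
  then show ?thesis
    by (simp add: star_less not_less)
qed

end

section \<open>Infinitely small elements, standard parts and galaxies\<close>

lemma infinitely_small_0 [simp]: "infinitely_small 0"
  by (simp add: infinitely_small_def)

lemma infinitely_small_minus_commute: "infinitely_small (s - t) \<longleftrightarrow> infinitely_small (t - s)"
  by (simp add: infinitely_small_def abs_minus_commute)

lemma infinitely_small_squeeze: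
  "\<bar>s\<bar> \<le> \<bar>t\<bar> \<Longrightarrow> infinitely_small t \<Longrightarrow> infinitely_small s"
  unfolding infinitely_small_def by (meson le_less_trans)

lemma infinitely_small_add:
  assumes "infinitely_small s" "infinitely_small t"
  shows "infinitely_small (s + t)"
  unfolding infinitely_small_def
proof (intro allI impI)
  fix n :: nat
  assume n: "1 \<le> n"
  then have "1 \<le> 2 * n"
    by simp
  then have "\<bar>s\<bar> < 1 / of_nat (2 * n)" "\<bar>t\<bar> < 1 / of_nat (2 * n)"
    using assms unfolding infinitely_small_def by blast+
  then have "\<bar>s\<bar> + \<bar>t\<bar> < 1 / of_nat (2 * n) + 1 / of_nat (2 * n)"
    by (rule add_strict_mono)
  also have "\<dots> = 1 / of_nat n"
    using n by (simp add: field_simps)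
  finally show "\<bar>s + t\<bar> < 1 / of_nat n"
    using abs_triangle_ineq[of s t] by linarith
qed

lemma infinitely_small_limited: "infinitely_small s \<Longrightarrow> limited s"
  unfolding infinitely_small_def limited_iff
  by (rule exI[of _ 1]) (auto dest: spec[of _ 1])

lemma limited_mult:
  assumes "limited s" "limited t" shows "limited (s * t)"
proof -
  obtain m n :: nat where "\<bar>s\<bar> \<le> of_nat m" "\<bar>t\<bar> \<le> of_nat n"
    using assms by (auto simp: limited_iff)
  then have "\<bar>s * t\<bar> \<le> of_nat (m * n)"
    unfolding abs_mult of_nat_mult by (intro mult_mono) auto
  then show ?thesis
    unfolding limited_iff by blast
qed

lemma limited_cong:
  assumes "limited (s - t)" shows "limited s \<longleftrightarrow> limited t"
  using limited_add[OF assms, of t] limited_add[OF assms[unfolded limited_minus_commute[of s t]], of s]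
  by auto

lemma Gal_cases: obtains t where "\<tau> = Gal t"
  by (metis Quotient3_abs_rep Quotient3_gal)

lemma Gal_0: "Gal 0 = 0"
  by (simp add: zero_gal_def)

lemma Gal_eq_iff: "Gal s = Gal t \<longleftrightarrow> limited (s - t)"
  by (rule gal.abs_eq_iff)

lemma Gal_le_iff: "Gal s \<le> Gal t \<longleftrightarrow> s \<le> t \<or> limited (s - t)"
  by (rule less_eq_gal.abs_eq)

lemma Gal_add: "Gal (s + t) = Gal s + Gal t"
  by (simp add: plus_gal.abs_eq)

text \<open>Multiplication by a limited element keeps limited differences limited, so the result
  does not depend on the representative \<open>t\<close>.\<close>

lemma gal_scale_Gal:
  assumes "limited \<gamma>" shows "gal_scale \<gamma> (Gal t) = Gal (\<gamma> * t)"
  unfolding gal_scale_def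
proof (rule the_equality)
  show "\<forall>t'. Gal t' = Gal t \<longrightarrow> Gal (\<gamma> * t) = Gal (\<gamma> * t')"
    using limited_mult[OF assms]
    by (simp add: Gal_eq_iff limited_minus_commute[of _ t] flip: right_diff_distrib)
qed blast

lemma gal_scale_1: "gal_scale 1 \<tau> = \<tau>"
proof -
  have "limited (1::'a)"
    unfolding limited_iff by (rule exI[of _ 1]) simp
  then show ?thesis
    by (cases \<tau> rule: Gal_cases) (simp add: gal_scale_Gal)
qed

section \<open>Standard parts\<close>

context nonstandard_extension
begin

text \<open>Two standard parts of \<open>s\<close> differ by an infinitely small standard real,
  while by the Archimedean property a nonzero real exceeds some \<open>1 / n\<close> in absolute
  value.\<close>

lemma standard_part_unique:
  assumes "infinitely_small (s - star_real star r)" "infinitely_small (s - star_real star r')"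
  shows "r = r'"
proof (rule ccontr)
  assume "r \<noteq> r'"
  then obtain n :: nat where n: "1 / real n < \<bar>r - r'\<bar>" "n \<noteq> 0"
    using reals_Archimedean[of "\<bar>r - r'\<bar>"]
    by (metis inverse_eq_divide nat.distinct(2) right_minus_eq zero_less_abs_iff)
  have "infinitely_small ((star_real star r - s) + (s - star_real star r'))"
    using assms by (intro infinitely_small_add) (simp_all add: infinitely_small_minus_commute)
  then have "infinitely_small (star_real star (r - r'))"
    by (simp add: star_real_diff)
  then have "\<bar>star_real star (r - r')\<bar> < star_real star (1 / real n)"
    using n unfolding infinitely_small_def by simp
  then have "star_real star (r - r') < star_real star (1 / real n)"
    "star_real star (- (r - r')) < star_real star (1 / real n)"
    unfolding star_real_minus by linarith+
  then show False
    using n unfolding star_real_less by linarith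
qed

text \<open>The standard part is the supremum of the standard reals below \<open>s\<close>.
  Limitedness makes this set nonempty and bounded, so completeness of the reals applies.\<close>

lemma standard_part_exists:
  assumes "limited s" obtains r where "infinitely_small (s - star_real star r)"
proof -
  define A where "A = {x. star_real star x \<le> s}"
  obtain k :: nat where k: "\<bar>s\<bar> \<le> of_nat k"
    using assms limited_iff by blast
  have "star_real star (- real k) \<le> s"
    using k by (simp add: star_real_minus abs_le_iff)
  then have ne: "A \<noteq> {}"
    unfolding A_def by blast
  have "x \<le> real k" if "x \<in> A" for x
  proof -
    have "star_real star x \<le> star_real star (real k)"
      using that k unfolding A_def by simp
    then show ?thesis
      by (simp only: star_real_le)
  qed
  then have bdd: "bdd_above A"
    by (rule bdd_aboveI)
  have "\<bar>s - star_real star (Sup A)\<bar> < 1 / of_nat n" if "n \<ge> 1" for n :: nat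
  proof -
    have pos: "1 / real n > 0"
      using that by simp
    have "Sup A + 1 / real n / 2 \<notin> A"
      using cSup_upper[OF _ bdd, of "Sup A + 1 / real n / 2"] pos by fastforce
    then have "s < star_real star (Sup A + 1 / real n / 2)"
      by (simp add: A_def not_le)
    also have "\<dots> < star_real star (Sup A + 1 / real n)"
      unfolding star_real_less using that by (simp add: field_simps)
    finally have upper: "s - star_real star (Sup A) < 1 / of_nat n"
      by (simp add: star_real_add algebra_simps)
    obtain x where x: "x \<in> A" "Sup A - 1 / real n < x"
      using less_cSupD[OF ne, of "Sup A - 1 / real n"] pos by auto
    then have "star_real star (Sup A - 1 / real n) < star_real star x"
      by simp
    also have "\<dots> \<le> s"
      using x by (simp add: A_def)
    finally have "star_real star (Sup A) - s < 1 / of_nat n"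
      by (simp add: star_real_diff algebra_simps)
    with upper show ?thesis
      by (simp add: abs_less_iff)
  qed
  then show thesis
    using that[of "Sup A"] unfolding infinitely_small_def by blast
qed

lemma limited_star_real [simp]: "limited (star_real star r)"
proof -
  obtain n :: nat where "\<bar>r\<bar> \<le> real n"
    using real_arch_simple by blast
  then have "star_real star r \<le> star_real star (real n)" "star_real star (- r) \<le> star_real star (real n)"
    unfolding star_real_le by linarith+
  then show ?thesis
    unfolding limited_iff by (metis abs_le_iff star_real_minus star_real_of_nat)
qed

lemma st_eq_Fin:
  assumes "infinitely_small (s - star_real star r)" shows "st star s = Fin r"
proof -
  have "limited s"
    using limited_cong[OF infinitely_small_limited[OF assms]] by simp
  then show ?thesis
    using assms standard_part_unique by (auto simp: st_def intro!: the_equality)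
qed

lemma st_eq_Pinf: "\<not> limited s \<Longrightarrow> 0 \<le> s \<Longrightarrow> st star s = Pinf"
  unfolding st_def by (metis limited_0 order_le_less)

lemma st_less_Pinf_iff:
  assumes "0 \<le> s" shows "st star s < Pinf \<longleftrightarrow> limited s"
  using st_eq_Pinf[OF _ assms] by (cases "limited s") (auto simp: st_def)

lemma st_0 [simp]: "st star 0 = 0"
  using st_eq_Fin[of 0 0] by (simp add: zero_extended_def)

lemma st_mono:
  assumes "0 \<le> s" "s \<le> t" shows "st star s \<le> st star t"
proof (cases "limited t")
  case True
  then have "limited s"
    using limited_squeeze assms by blast
  then obtain a where a: "infinitely_small (s - star_real star a)"
    using standard_part_exists by blast
  obtain b where b: "infinitely_small (t - star_real star b)"
    using standard_part_exists True by blast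
  have "a \<le> b"
  proof (rule ccontr)
    assume "\<not> a \<le> b"
    then have ab: "star_real star b < star_real star a"
      by simp
    have "infinitely_small (star_real star a - star_real star b)"
    proof (rule infinitely_small_squeeze)
      \<comment> \<open>Since \<open>s \<le> t\<close>, this sum of two infinitely small terms is at
        least the positive difference of the images of \<open>a\<close> and
        \<open>b\<close>.\<close>
      show "infinitely_small ((star_real star a - s) + (t - star_real star b))"
        using a b by (intro infinitely_small_add) (simp_all add: infinitely_small_minus_commute)
      show "\<bar>star_real star a - star_real star b\<bar> \<le> \<bar>(star_real star a - s) + (t - star_real star b)\<bar>"
        using ab assms by simp
    qed
    then show False
      using standard_part_unique[of "star_real star a" a b] ab by auto
  qed
  then show ?thesis
    by (simp add: st_eq_Fin[OF a] st_eq_Fin[OF b])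
next
  case False
  then show ?thesis
    using st_eq_Pinf[of t] assms by auto
qed

lemma st_nonneg: "0 \<le> s \<Longrightarrow> 0 \<le> st star s"
  using st_mono[of 0 s] by simp

lemma st_add:
  assumes "0 \<le> s" "0 \<le> t" shows "st star (s + t) = st star s + st star t"
proof (cases "limited s \<and> limited t")
  case True
  then obtain a b where ab: "infinitely_small (s - star_real star a)"
      "infinitely_small (t - star_real star b)"
    using standard_part_exists by metis
  then have "infinitely_small (s + t - star_real star (a + b))"
    using infinitely_small_add[OF ab] by (simp add: star_real_add algebra_simps)
  then show ?thesis
    using ab by (simp add: st_eq_Fin)
next
  case False
  moreover have "\<not> limited (s + t)"
    using False limited_squeeze[of s "s + t"] limited_squeeze[of t "s + t"] assms by auto
  ultimately have "st star (s + t) = Pinf" "st star s = Pinf \<or> st star t = Pinf"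
    using st_eq_Pinf assms by auto
  moreover have "st star s \<noteq> Minf" "st star t \<noteq> Minf"
    using st_nonneg[OF assms(1)] st_nonneg[OF assms(2)] by (auto simp: zero_extended_def)
  ultimately show ?thesis
    by (cases "st star s"; cases "st star t") auto
qed

text \<open>Provides the independence of \<open>scaled_delta\<close> from representatives, whose
  change moves a scaled distance by an infinitely small amount only.\<close>

lemma st_cong:
  assumes "0 \<le> s" "0 \<le> t" "infinitely_small (s - t)"
  shows "st star s = st star t"
proof (cases "limited t")
  case True
  then obtain b where b: "infinitely_small (t - star_real star b)"
    using standard_part_exists by blast
  have "infinitely_small (s - star_real star b)"
    using infinitely_small_add[OF assms(3) b] by simp
  then show ?thesis
    using b by (simp add: st_eq_Fin)
next
  case False
  then have "\<not> limited s"
    using limited_cong[OF infinitely_small_limited[OF assms(3)]] by simp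
  then show ?thesis
    using False st_eq_Pinf assms by simp
qed

text \<open>This gives the separation property of a scaling: distance 0 there is the relation that
  was factored out.\<close>

lemma st_eq_0_iff:
  assumes "0 \<le> s" shows "st star s = 0 \<longleftrightarrow> infinitely_small s"
proof
  assume 0: "st star s = 0"
  then have "limited s"
    using st_less_Pinf_iff[OF assms] by (simp add: zero_extended_def)
  then obtain a where a: "infinitely_small (s - star_real star a)"
    using standard_part_exists by blast
  then have "a = 0"
    using st_eq_Fin 0 by (simp add: zero_extended_def)
  then show "infinitely_small s"
    using a by simp
qed (use st_cong[of s 0] assms in simp)

end

section \<open>Metric components\<close>

lemma metric_rule_refl: "metric_rule Y d \<Longrightarrow> x \<in> Y \<Longrightarrow> d x x = 0"
  by (simp add: metric_rule_def)

lemma metric_rule_nonneg: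
  assumes "metric_rule Y d" "x \<in> Y" "y \<in> Y" shows "0 \<le> d x y"
proof (cases "x = y")
  case False
  then have "0 < d x y"
    using assms unfolding metric_rule_def by metis
  then show ?thesis
    by (rule less_imp_le)
qed (use metric_rule_refl[OF assms(1)] assms in simp)

text \<open>If the left side of the triangle inequality is infinite, the two end points differ, so
  at least one step on the right is infinite as well. Serves for both distances of the
  limit.\<close>

lemma metric_rule_discrete:
  "metric_rule A (\<lambda>\<xi> \<eta>. if \<xi> = \<eta> then 0 else Pinf :: 'v::linordered_ab_group_add extended)"
  by (auto simp: metric_rule_def zero_extended_def)

text \<open>An explicit form of the classes in the quotient \<open>components\<close>, so that a
  component can be named by any of its points.\<close>

definition component :: "('a, 'r::linordered_field) space \<Rightarrow> 'a \<Rightarrow> 'a set" where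
  "component S x = {y \<in> points S. small_dist S x y < Pinf}"

lemma comps_eq: "comps S = component S ` points S"
  by (auto simp: components_def quotient_def component_def)

lemma componentI: "x \<in> points S \<Longrightarrow> component S x \<in> comps S"
  by (simp add: comps_eq)

lemma extended_add_less_Pinf: "x < Pinf \<Longrightarrow> y < Pinf \<Longrightarrow> x + y < Pinf" for x y :: "real extended"
  by (cases x; cases y) auto

context
  fixes S :: "('a, 'r::linordered_field) space"
  assumes S: "metric_rule (points S) (small_dist S)"
begin

lemma small_dist_commute: "x \<in> points S \<Longrightarrow> y \<in> points S \<Longrightarrow> small_dist S x y = small_dist S y x"
  using S unfolding metric_rule_def by metis

lemma component_self: "x \<in> points S \<Longrightarrow> x \<in> component S x"
  by (simp add: component_def metric_rule_refl[OF S] zero_extended_def)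

lemma small_dist_less_Pinf_trans:
  assumes "x \<in> points S" "y \<in> points S" "z \<in> points S"
    and "small_dist S x y < Pinf" "small_dist S y z < Pinf"
  shows "small_dist S x z < Pinf"
proof -
  have "small_dist S x z \<le> small_dist S x y + small_dist S y z"
    using assms S unfolding metric_rule_def by blast
  then show ?thesis
    using extended_add_less_Pinf[OF assms(4,5)] by (rule le_less_trans)
qed

lemma component_eq:
  assumes "x \<in> points S" "y \<in> component S x" shows "component S y = component S x"
proof -
  have y: "y \<in> points S" "small_dist S x y < Pinf" "small_dist S y x < Pinf"
    using assms small_dist_commute by (auto simp: component_def)
  show ?thesis
    using small_dist_less_Pinf_trans[OF assms(1) y(1)] small_dist_less_Pinf_trans[OF y(1) assms(1)] y
    by (auto simp: component_def)
qed

lemma comps_component: "E \<in> comps S \<Longrightarrow> x \<in> E \<Longrightarrow> E = component S x"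
  using component_eq by (auto simp: comps_eq)

lemma comps_subset_points: "E \<in> comps S \<Longrightarrow> x \<in> E \<Longrightarrow> x \<in> points S"
  by (auto simp: comps_eq component_def)

lemma comps_nonempty:
  assumes "E \<in> comps S" obtains x where "x \<in> E"
  using assms component_self by (auto simp: comps_eq)

end

text \<open>By \<open>fin\<close> all of \<open>E\<close> lands in the component of
  \<open>f x\<close>, and distinct components share no point. Asking only that finite distances stay
  finite makes the result available while \<open>f\<close> is still being shown to be a
  morphism.\<close>

lemma induced_eq_component:
  fixes S :: "('a, 'r::linordered_field) space" and S' :: "('b, 'r) space"
  assumes S: "metric_rule (points S) (small_dist S)"
    and S': "metric_rule (points S') (small_dist S')"
    and f: "\<And>x. x \<in> points S \<Longrightarrow> f x \<in> points S'"
    and fin: "\<And>x y. x \<in> points S \<Longrightarrow> y \<in> points S \<Longrightarrow> small_dist S x y < Pinf \<Longrightarrow>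
      small_dist S' (f x) (f y) < Pinf"
    and E: "E \<in> comps S" "x \<in> E"
  shows "induced S S' f E = component S' (f x)"
  unfolding induced_def
proof (rule the_equality)
  have x: "x \<in> points S" "E = component S x"
    using comps_component[OF S] comps_subset_points[OF S] E by blast+
  show "component S' (f x) \<in> comps S' \<and> f ` E \<subseteq> component S' (f x)"
  proof
    show "component S' (f x) \<in> comps S'"
      using f x by (blast intro: componentI)
    show "f ` E \<subseteq> component S' (f x)"
      using f fin x by (auto simp: component_def)
  qed
next
  fix E' assume "E' \<in> comps S' \<and> f ` E \<subseteq> E'"
  then show "E' = component S' (f x)"
    using comps_component[OF S'] E by blast
qed

lemma induced_morphism:
  assumes "generalized_galactic S" "generalized_galactic S'" "morphism \<iota> S S' f"
    and "E \<in> comps S" "x \<in> E"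
  shows "induced S S' f E = component S' (f x)"
proof (rule induced_eq_component)
  fix x y
  assume xy: "x \<in> points S" "y \<in> points S" "small_dist S x y < Pinf"
  obtain \<gamma> where "map_extended \<iota> (small_dist S' (f x) (f y))
      \<le> map_extended (\<lambda>s. \<gamma> * \<iota> s) (small_dist S x y)"
    using assms(3) xy unfolding morphism_def by blast
  then show "small_dist S' (f x) (f y) < Pinf"
    using xy(3) by (cases "small_dist S' (f x) (f y)"; cases "small_dist S x y") auto
qed (use assms in \<open>auto simp: generalized_galactic_def morphism_def\<close>)

text \<open>Every morphism constructed below admits the constant 1. The condition on components is
  tested at points, which avoids \<open>induced\<close>.\<close>

lemma (in nonstandard_extension) nonexpanding_morphismI:
  assumes "generalized_galactic S" "generalized_galactic S'"
    and f: "f \<in> points S \<rightarrow>\<^sub>E points S'"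
    and small: "\<And>x y. x \<in> points S \<Longrightarrow> y \<in> points S \<Longrightarrow> small_dist S' (f x) (f y) \<le> small_dist S x y"
    and large: "\<And>E F x y. E \<in> comps S \<Longrightarrow> F \<in> comps S \<Longrightarrow> x \<in> E \<Longrightarrow> y \<in> F \<Longrightarrow>
      large_dist S' (component S' (f x)) (component S' (f y)) \<le> large_dist S E F"
  shows "morphism (star_real star) S S' f"
  unfolding morphism_def
proof (intro conjI exI[of _ 1] ballI)
  show "limited (1::'r)"
    using limited_star_real[of 1] by simp
  fix x y assume "x \<in> points S" "y \<in> points S"
  then show "map_extended (star_real star) (small_dist S' (f x) (f y))
      \<le> map_extended (\<lambda>s. 1 * star_real star s) (small_dist S x y)"
    using small[of x y] by (cases "small_dist S' (f x) (f y)"; cases "small_dist S x y") auto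
next
  have S: "metric_rule (points S) (small_dist S)" "metric_rule (points S') (small_dist S')"
    using assms by (simp_all add: generalized_galactic_def)
  fix E F assume EF: "E \<in> comps S" "F \<in> comps S"
  obtain x where x: "x \<in> E"
    using comps_nonempty[OF S(1) EF(1)] by blast
  obtain y where y: "y \<in> F"
    using comps_nonempty[OF S(1) EF(2)] by blast
  have ind: "induced S S' f G = component S' (f z)" if "G \<in> comps S" "z \<in> G" for G z
  proof (rule induced_eq_component[OF S _ _ that])
    show "f x \<in> points S'" if "x \<in> points S" for x
      using f that by (rule PiE_mem)
    show "small_dist S' (f x) (f y) < Pinf"
      if "x \<in> points S" "y \<in> points S" "small_dist S x y < Pinf" for x y
      using small[OF that(1,2)] that(3) by (rule le_less_trans)
  qed
  have id: "map_extended (gal_scale 1) v = v" for v :: "'r gal extended"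
    by (cases v) (simp_all add: gal_scale_1)
  show "large_dist S' (induced S S' f E) (induced S S' f F)
      \<le> map_extended (gal_scale 1) (large_dist S E F)"
    unfolding id ind[OF EF(1) x] ind[OF EF(2) y] by (rule large[OF EF x y])
qed (use f in simp_all)

section \<open>The scalings of a metric space\<close>

context nonstandard_metric
begin

abbreviation "proj \<equiv> scaling_proj star M d"

abbreviation "X \<equiv> scaling star M d"

text \<open>Two triangle inequalities for each sign. The bound controls a change of both
  representatives at once and underlies the well-definedness of both distances of a scaling.\<close>

lemma star_dist_diff:
  assumes "x \<in> starM" "x' \<in> starM" "y \<in> starM" "y' \<in> starM"
  shows "\<bar>stard x y - stard x' y'\<bar> \<le> stard x x' + stard y y'"
proof -
  have "stard x y \<le> stard x x' + stard x' y" "stard x' y \<le> stard x' y' + stard y' y"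
    "stard x' y' \<le> stard x' x + stard x y'" "stard x y' \<le> stard x y + stard y y'"
    using assms star_dist_triangle by blast+
  then show ?thesis
    using assms star_dist_commute[of x' x] star_dist_commute[of y' y] by (simp add: abs_le_iff)
qed

lemma scaled_dist_diff:
  assumes "0 < \<alpha>" "x \<in> starM" "x' \<in> starM" "y \<in> starM" "y' \<in> starM"
  shows "\<bar>\<alpha> * stard x y - \<alpha> * stard x' y'\<bar> \<le> \<alpha> * stard x x' + \<alpha> * stard y y'"
proof -
  have "\<bar>\<alpha> * stard x y - \<alpha> * stard x' y'\<bar> = \<alpha> * \<bar>stard x y - stard x' y'\<bar>"
    using assms(1) by (simp add: abs_mult flip: right_diff_distrib)
  also have "\<dots> \<le> \<alpha> * (stard x x' + stard y y')"
    using assms star_dist_diff by (intro mult_left_mono) auto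
  finally show ?thesis
    by (simp add: distrib_left)
qed

lemma scaled_dist_nonneg: "0 < \<alpha> \<Longrightarrow> x \<in> starM \<Longrightarrow> y \<in> starM \<Longrightarrow> 0 \<le> \<alpha> * stard x y"
  by (simp add: star_dist_nonneg)

lemma scaled_dist_triangle:
  assumes "0 < \<alpha>" "x \<in> starM" "y \<in> starM" "z \<in> starM"
  shows "\<alpha> * stard x z \<le> \<alpha> * stard x y + \<alpha> * stard y z"
  using mult_left_mono[OF star_dist_triangle[OF assms(2-4)], of \<alpha>] assms(1)
  by (simp add: distrib_left)

lemma equiv_near_rel:
  assumes "0 < \<alpha>" shows "equiv starM (near_rel star M d \<alpha>)"
proof (rule equivI)
  show "near_rel star M d \<alpha> \<subseteq> starM \<times> starM"
    by (auto simp: near_rel_def)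
  show "refl_on starM (near_rel star M d \<alpha>)"
    by (auto simp: refl_on_def near_rel_def star_dist_refl)
  show "sym (near_rel star M d \<alpha>)"
    by (auto simp: sym_def near_rel_def star_dist_commute)
  show "trans (near_rel star M d \<alpha>)"
  proof (rule transI)
    fix x y z
    assume "(x, y) \<in> near_rel star M d \<alpha>" "(y, z) \<in> near_rel star M d \<alpha>"
    then have m: "x \<in> starM" "y \<in> starM" "z \<in> starM"
      and small: "infinitely_small (\<alpha> * stard x y + \<alpha> * stard y z)"
      by (auto simp: near_rel_def intro: infinitely_small_add)
    have "\<bar>\<alpha> * stard x z\<bar> \<le> \<bar>\<alpha> * stard x y + \<alpha> * stard y z\<bar>"
      using scaled_dist_nonneg[OF assms m(1,3)] scaled_dist_triangle[OF assms m] by linarith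
    then show "(x, z) \<in> near_rel star M d \<alpha>"
      using m small infinitely_small_squeeze by (auto simp: near_rel_def)
  qed
qed

lemma proj_eq_iff:
  assumes "0 < \<alpha>" "x \<in> starM" "y \<in> starM"
  shows "proj \<alpha> x = proj \<alpha> y \<longleftrightarrow> infinitely_small (\<alpha> * stard x y)"
  using eq_equiv_class_iff[OF equiv_near_rel[OF assms(1)] assms(2,3)] assms
  by (simp add: scaling_proj_def near_rel_def)

lemma scaled_points_eq: "scaled_points star M d \<alpha> = proj \<alpha> ` starM"
  by (auto simp: scaled_points_def scaling_proj_def quotient_def)

lemma points_scaling [simp]: "points (X \<alpha>) = proj \<alpha> ` starM"
  by (simp add: scaling_def scaled_points_eq)

text \<open>Other representatives are infinitely close at scale \<open>\<alpha>\<close>, so by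
  \<open>scaled_dist_diff\<close> the argument of \<open>st\<close> moves by an infinitely small
  amount.\<close>

lemma small_dist_scaling [simp]:
  assumes \<alpha>: "0 < \<alpha>" and xy: "x \<in> starM" "y \<in> starM"
  shows "small_dist (X \<alpha>) (proj \<alpha> x) (proj \<alpha> y) = st star (\<alpha> * stard x y)"
proof -
  have "st star (\<alpha> * stard x y) = st star (\<alpha> * stard x' y')"
    if xy': "x' \<in> starM" "y' \<in> starM" "proj \<alpha> x' = proj \<alpha> x" "proj \<alpha> y' = proj \<alpha> y" for x' y'
  proof (rule st_cong)
    have "infinitely_small (\<alpha> * stard x x' + \<alpha> * stard y y')"
      using xy xy' proj_eq_iff[OF \<alpha>] by (intro infinitely_small_add) metis+
    moreover have "\<bar>\<alpha> * stard x y - \<alpha> * stard x' y'\<bar> \<le> \<bar>\<alpha> * stard x x' + \<alpha> * stard y y'\<bar>"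
      using scaled_dist_diff[OF \<alpha> xy(1) xy'(1) xy(2) xy'(2)] by linarith
    ultimately show "infinitely_small (\<alpha> * stard x y - \<alpha> * stard x' y')"
      using infinitely_small_squeeze by blast
  qed (use \<alpha> xy xy' in \<open>simp_all add: scaled_dist_nonneg\<close>)
  then have "scaled_delta star M d \<alpha> (proj \<alpha> x) (proj \<alpha> y) = st star (\<alpha> * stard x y)"
    unfolding scaled_delta_def using xy by (intro the_equality) (metis+)
  then show ?thesis
    by (simp add: scaling_def)
qed

lemma metric_rule_small_dist_scaling:
  assumes \<alpha>: "0 < \<alpha>" shows "metric_rule (points (X \<alpha>)) (small_dist (X \<alpha>))"
  \<comment> \<open>\<open>ball_simps\<close> turns quantifiers over the image of
    \<open>proj\<close> into quantifiers over representatives.\<close>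
  unfolding metric_rule_def points_scaling ball_simps
proof (intro conjI ballI impI)
  fix x assume "x \<in> starM"
  then show "small_dist (X \<alpha>) (proj \<alpha> x) (proj \<alpha> x) = 0"
    using \<alpha> by (simp add: star_dist_refl)
next
  fix x y assume xy: "x \<in> starM" "y \<in> starM"
  then show "small_dist (X \<alpha>) (proj \<alpha> x) (proj \<alpha> y) = small_dist (X \<alpha>) (proj \<alpha> y) (proj \<alpha> x)"
    using \<alpha> by (simp add: star_dist_commute)
  assume "proj \<alpha> x \<noteq> proj \<alpha> y"
  then have "st star (\<alpha> * stard y x) \<noteq> 0"
    using proj_eq_iff[OF \<alpha> xy] st_eq_0_iff scaled_dist_nonneg[OF \<alpha> xy] star_dist_commute[OF xy] by simp
  then show "0 < small_dist (X \<alpha>) (proj \<alpha> y) (proj \<alpha> x)"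
    using xy \<alpha> st_nonneg[OF scaled_dist_nonneg[OF \<alpha> xy(2,1)]] by simp
next
  fix x y z assume xyz: "x \<in> starM" "y \<in> starM" "z \<in> starM"
  have "st star (\<alpha> * stard x z) \<le> st star (\<alpha> * stard x y + \<alpha> * stard y z)"
    using xyz \<alpha> by (intro st_mono scaled_dist_nonneg scaled_dist_triangle)
  also have "\<dots> = st star (\<alpha> * stard x y) + st star (\<alpha> * stard y z)"
    using xyz \<alpha> by (intro st_add scaled_dist_nonneg)
  finally show "small_dist (X \<alpha>) (proj \<alpha> x) (proj \<alpha> z)
      \<le> small_dist (X \<alpha>) (proj \<alpha> x) (proj \<alpha> y) + small_dist (X \<alpha>) (proj \<alpha> y) (proj \<alpha> z)"
    using xyz \<alpha> by simp
qed

text \<open>Links components with galaxies: \<open>st\<close> is finite exactly on the limited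
  elements, and \<open>Gal\<close> identifies elements whose difference is limited.\<close>

lemma proj_mem_component_iff:
  assumes "0 < \<alpha>" "x \<in> starM" "y \<in> starM"
  shows "proj \<alpha> y \<in> component (X \<alpha>) (proj \<alpha> x) \<longleftrightarrow> limited (\<alpha> * stard x y)"
  using assms by (simp add: component_def st_less_Pinf_iff star_dist_nonneg)

lemma proj_same_comps:
  assumes "0 < \<alpha>" "x \<in> starM" "y \<in> starM" "E \<in> comps (X \<alpha>)" "proj \<alpha> x \<in> E"
  shows "proj \<alpha> y \<in> E \<longleftrightarrow> limited (\<alpha> * stard x y)"
  using proj_mem_component_iff[OF assms(1-3)]
    comps_component[OF metric_rule_small_dist_scaling[OF assms(1)] assms(4,5)] by simp

lemma comps_scaling_cases:
  assumes "0 < \<alpha>" "E \<in> comps (X \<alpha>)"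
  obtains x where "x \<in> starM" "proj \<alpha> x \<in> E"
proof -
  note m = metric_rule_small_dist_scaling[OF assms(1)]
  obtain u where u: "u \<in> E"
    using comps_nonempty[OF m assms(2)] by blast
  then have "u \<in> points (X \<alpha>)"
    using comps_subset_points[OF m assms(2)] by blast
  then show thesis
    using that u by auto
qed

text \<open>Moving the points inside their components changes the scaled distance by a limited
  amount, which \<open>Gal\<close> does not see.\<close>

lemma large_dist_scaling:
  assumes \<alpha>: "0 < \<alpha>" and xy: "x \<in> starM" "y \<in> starM"
    and E: "E \<in> comps (X \<alpha>)" "proj \<alpha> x \<in> E" and F: "F \<in> comps (X \<alpha>)" "proj \<alpha> y \<in> F"
  shows "large_dist (X \<alpha>) E F = Fin (Gal (\<alpha> * stard x y))"
proof -
  have "Gal (\<alpha> * stard x y) = Gal (\<alpha> * stard x' y')"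
    if xy': "x' \<in> starM" "y' \<in> starM" "proj \<alpha> x' \<in> E" "proj \<alpha> y' \<in> F" for x' y'
  proof -
    have lim: "limited (\<alpha> * stard x x' + \<alpha> * stard y y')"
      using proj_same_comps[OF \<alpha>] xy xy' E F by (intro limited_add) blast+
    have "limited \<bar>\<alpha> * stard x y - \<alpha> * stard x' y'\<bar>"
      using limited_squeeze[OF abs_ge_zero scaled_dist_diff[OF \<alpha> xy(1) xy'(1) xy(2) xy'(2)] lim] .
    then show ?thesis
      by (simp add: Gal_eq_iff limited_iff)
  qed
  then have "scaled_Delta star M d \<alpha> E F = Gal (\<alpha> * stard x y)"
    unfolding scaled_Delta_def using xy E F by (intro the_equality) (metis+)
  then show ?thesis
    by (simp add: scaling_def)
qed

text \<open>Distinct components lie at unlimited scaled distance, hence at positive galactic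
  distance. The triangle inequality passes through \<open>Gal\<close>, which is additive and
  monotone.\<close>

lemma metric_rule_large_dist_scaling:
  assumes \<alpha>: "0 < \<alpha>" shows "metric_rule (comps (X \<alpha>)) (large_dist (X \<alpha>))"
  unfolding metric_rule_def
proof (intro conjI ballI impI)
  fix E assume E: "E \<in> comps (X \<alpha>)"
  obtain x where x: "x \<in> starM" "proj \<alpha> x \<in> E"
    using comps_scaling_cases[OF \<alpha> E] by blast
  then show "large_dist (X \<alpha>) E E = 0"
    using large_dist_scaling[OF \<alpha> x(1) x(1) E x(2) E x(2)]
    by (simp add: star_dist_refl Gal_0 zero_extended_def)
next
  fix E F assume EF: "E \<in> comps (X \<alpha>)" "F \<in> comps (X \<alpha>)"
  obtain x where x: "x \<in> starM" "proj \<alpha> x \<in> E"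
    using comps_scaling_cases[OF \<alpha> EF(1)] by blast
  obtain y where y: "y \<in> starM" "proj \<alpha> y \<in> F"
    using comps_scaling_cases[OF \<alpha> EF(2)] by blast
  have EF_eq: "large_dist (X \<alpha>) E F = Fin (Gal (\<alpha> * stard x y))"
    using large_dist_scaling[OF \<alpha> x(1) y(1) EF(1) x(2) EF(2) y(2)] .
  have FE_eq: "large_dist (X \<alpha>) F E = Fin (Gal (\<alpha> * stard x y))"
    using large_dist_scaling[OF \<alpha> y(1) x(1) EF(2) y(2) EF(1) x(2)] star_dist_commute[OF x(1) y(1)] by simp
  show "large_dist (X \<alpha>) E F = large_dist (X \<alpha>) F E"
    using EF_eq FE_eq by simp
  assume "E \<noteq> F"
  then have "proj \<alpha> y \<notin> E"
    using comps_component[OF metric_rule_small_dist_scaling[OF \<alpha>]] EF y by blast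
  then have "\<not> limited (\<alpha> * stard x y)"
    using proj_same_comps[OF \<alpha> x(1) y(1) EF(1) x(2)] by simp
  then have "Gal 0 \<le> Gal (\<alpha> * stard x y)" "Gal 0 \<noteq> Gal (\<alpha> * stard x y)"
    using scaled_dist_nonneg[OF \<alpha> x(1) y(1)] unfolding Gal_le_iff Gal_eq_iff by simp_all
  then show "0 < large_dist (X \<alpha>) F E"
    using FE_eq by (simp add: zero_extended_def Gal_0)
next
  fix E F G assume EFG: "E \<in> comps (X \<alpha>)" "F \<in> comps (X \<alpha>)" "G \<in> comps (X \<alpha>)"
  obtain x where x: "x \<in> starM" "proj \<alpha> x \<in> E"
    using comps_scaling_cases[OF \<alpha> EFG(1)] by blast
  obtain y where y: "y \<in> starM" "proj \<alpha> y \<in> F"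
    using comps_scaling_cases[OF \<alpha> EFG(2)] by blast
  obtain z where z: "z \<in> starM" "proj \<alpha> z \<in> G"
    using comps_scaling_cases[OF \<alpha> EFG(3)] by blast
  show "large_dist (X \<alpha>) E G \<le> large_dist (X \<alpha>) E F + large_dist (X \<alpha>) F G"
    using large_dist_scaling[OF \<alpha> x(1) y(1) EFG(1) x(2) EFG(2) y(2)]
      large_dist_scaling[OF \<alpha> y(1) z(1) EFG(2) y(2) EFG(3) z(2)]
      large_dist_scaling[OF \<alpha> x(1) z(1) EFG(1) x(2) EFG(3) z(2)]
      scaled_dist_triangle[OF \<alpha> x(1) y(1) z(1)]
    by (simp add: Gal_le_iff flip: Gal_add)
qed

lemma generalized_galactic_scaling: "0 < \<alpha> \<Longrightarrow> generalized_galactic (X \<alpha>)"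
  by (simp add: generalized_galactic_def metric_rule_small_dist_scaling metric_rule_large_dist_scaling
      del: points_scaling)

section \<open>Transition maps between the scalings\<close>

lemma proj_eq_coarsen:
  assumes "0 < \<beta>" "\<beta> \<le> \<alpha>" "x \<in> starM" "y \<in> starM" "proj \<alpha> x = proj \<alpha> y"
  shows "proj \<beta> x = proj \<beta> y"
proof -
  \<comment> \<open>Lowering the scale shrinks scaled distances, so infinitely small ones stay
    infinitely small.\<close>
  have "\<bar>\<beta> * stard x y\<bar> \<le> \<bar>\<alpha> * stard x y\<bar>"
    using assms by (simp add: abs_mult mult_right_mono)
  moreover have "infinitely_small (\<alpha> * stard x y)"
    using proj_eq_iff[of \<alpha> x y] assms by simp
  ultimately show ?thesis
    using proj_eq_iff[of \<beta> x y] assms infinitely_small_squeeze by blast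
qed

text \<open>Resolves the \<open>THE\<close> in \<open>scaling_map\<close>. The map \<open>r\<close>
  sends a class through a chosen representative, and \<open>proj_eq_coarsen\<close> makes the choice
  irrelevant. It is unique because every point of the source is a projection and maps are
  extensional.\<close>

lemma scaling_map:
  assumes "0 < \<beta>" "\<beta> \<le> \<alpha>"
  shows scaling_map_funcset:
      "scaling_map star M d \<beta> \<alpha> \<in> points (X \<alpha>) \<rightarrow>\<^sub>E points (X \<beta>)"
    and scaling_map_proj: "\<And>x. x \<in> starM \<Longrightarrow> scaling_map star M d \<beta> \<alpha> (proj \<alpha> x) = proj \<beta> x"
proof -
  let ?P = "\<lambda>p. p \<in> points (X \<alpha>) \<rightarrow>\<^sub>E points (X \<beta>) \<and> (\<forall>x\<in>starM. proj \<beta> x = p (proj \<alpha> x))"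
  define r where "r = (\<lambda>\<xi>\<in>points (X \<alpha>). proj \<beta> (SOME x. x \<in> starM \<and> proj \<alpha> x = \<xi>))"
  have r: "r (proj \<alpha> x) = proj \<beta> x" if "x \<in> starM" for x
  proof -
    define y where "y = (SOME y. y \<in> starM \<and> proj \<alpha> y = proj \<alpha> x)"
    have "y \<in> starM \<and> proj \<alpha> y = proj \<alpha> x"
      unfolding y_def by (rule someI[of _ x]) (simp add: that)
    then have "proj \<beta> y = proj \<beta> x"
      using proj_eq_coarsen[OF assms] that by blast
    then show ?thesis
      using that by (simp add: r_def y_def)
  qed
  have "?P r"
  proof (intro conjI)
    show "r \<in> points (X \<alpha>) \<rightarrow>\<^sub>E points (X \<beta>)"
    proof (rule PiE_I)
      fix \<xi> assume "\<xi> \<in> points (X \<alpha>)"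
      then show "r \<xi> \<in> points (X \<beta>)"
        using r by auto
    qed (simp add: r_def)
  qed (simp add: r)
  moreover have "p = r" if "?P p" for p
  proof (rule PiE_ext)
    show "p \<in> points (X \<alpha>) \<rightarrow>\<^sub>E points (X \<beta>)"
      using that by blast
    show "r \<in> points (X \<alpha>) \<rightarrow>\<^sub>E points (X \<beta>)"
      using \<open>?P r\<close> by blast
    fix \<xi> assume "\<xi> \<in> points (X \<alpha>)"
    then show "p \<xi> = r \<xi>"
      using that r by auto
  qed
  ultimately have "?P (THE p. ?P p)"
    by (rule theI)
  then have P: "?P (scaling_map star M d \<beta> \<alpha>)"
    unfolding scaling_map_def scaled_points_eq points_scaling .
  then show "scaling_map star M d \<beta> \<alpha> \<in> points (X \<alpha>) \<rightarrow>\<^sub>E points (X \<beta>)"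
    by (rule conjunct1)
  show "scaling_map star M d \<beta> \<alpha> (proj \<alpha> x) = proj \<beta> x" if "x \<in> starM" for x
    using bspec[OF conjunct2[OF P] that] by (rule sym)
qed

text \<open>Passing to a smaller scale shrinks distances, and both \<open>st\<close> and
  \<open>Gal\<close> are monotone.\<close>

lemma morphism_scaling_map:
  assumes "0 < \<beta>" "\<beta> \<le> \<alpha>"
  shows "morphism (star_real star) (X \<alpha>) (X \<beta>) (scaling_map star M d \<beta> \<alpha>)"
proof (rule nonexpanding_morphismI)
  have \<alpha>: "0 < \<alpha>"
    using assms by simp
  then show "generalized_galactic (X \<alpha>)" "generalized_galactic (X \<beta>)"
    using assms generalized_galactic_scaling by blast+
  show "scaling_map star M d \<beta> \<alpha> \<in> points (X \<alpha>) \<rightarrow>\<^sub>E points (X \<beta>)"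
    using scaling_map_funcset[OF assms] .
  have le: "\<beta> * stard x y \<le> \<alpha> * stard x y" if "x \<in> starM" "y \<in> starM" for x y
    using that assms by (simp add: mult_right_mono star_dist_nonneg)
  {
    fix \<xi> \<eta> assume "\<xi> \<in> points (X \<alpha>)" "\<eta> \<in> points (X \<alpha>)"
    then obtain x y where xy: "x \<in> starM" "y \<in> starM" "\<xi> = proj \<alpha> x" "\<eta> = proj \<alpha> y"
      by auto
    then show "small_dist (X \<beta>) (scaling_map star M d \<beta> \<alpha> \<xi>) (scaling_map star M d \<beta> \<alpha> \<eta>)
        \<le> small_dist (X \<alpha>) \<xi> \<eta>"
      using assms \<alpha> le by (simp add: scaling_map_proj st_mono star_dist_nonneg)
  }
  fix E F \<xi> \<eta> assume EF: "E \<in> comps (X \<alpha>)" "F \<in> comps (X \<alpha>)" "\<xi> \<in> E" "\<eta> \<in> F"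
  then have "\<xi> \<in> points (X \<alpha>)" "\<eta> \<in> points (X \<alpha>)"
    using comps_subset_points[OF metric_rule_small_dist_scaling[OF \<alpha>]] by blast+
  then obtain x y where xy: "x \<in> starM" "y \<in> starM" "\<xi> = proj \<alpha> x" "\<eta> = proj \<alpha> y"
    by auto
  have "large_dist (X \<alpha>) E F = Fin (Gal (\<alpha> * stard x y))"
    using large_dist_scaling[OF \<alpha>] xy EF by blast
  moreover have "large_dist (X \<beta>) (component (X \<beta>) (proj \<beta> x)) (component (X \<beta>) (proj \<beta> y))
      = Fin (Gal (\<beta> * stard x y))"
    using xy assms metric_rule_small_dist_scaling[OF assms(1)]
    by (intro large_dist_scaling componentI component_self) simp_all
  ultimately show "large_dist (X \<beta>) (component (X \<beta>) (scaling_map star M d \<beta> \<alpha> \<xi>))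
      (component (X \<beta>) (scaling_map star M d \<beta> \<alpha> \<eta>)) \<le> large_dist (X \<alpha>) E F"
    using xy assms le[OF xy(1,2)] by (simp add: scaling_map_proj Gal_le_iff)
qed

lemma inverse_system_scaling:
  "inverse_system (star_real star) scales X (scaling_map star M d)"
  unfolding inverse_system_def
proof (intro conjI ballI impI)
  have "(1 :: 'r) \<in> scales"
    by (simp add: scales_def)
  then show "(scales :: 'r set) \<noteq> {}"
    by (metis empty_iff)
next
  fix \<alpha> \<beta> :: 'r assume "\<alpha> \<in> scales" "\<beta> \<in> scales"
  then show "\<exists>\<gamma>\<in>scales. \<alpha> \<le> \<gamma> \<and> \<beta> \<le> \<gamma>"
    by (intro bexI[of _ "max \<alpha> \<beta>"]) (auto simp: scales_def)
next
  fix \<alpha> \<beta> :: 'r assume "\<alpha> \<in> scales" "\<beta> \<in> scales" "\<beta> \<le> \<alpha>"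
  then show "morphism (star_real star) (X \<alpha>) (X \<beta>) (scaling_map star M d \<beta> \<alpha>)"
    by (intro morphism_scaling_map) (simp_all add: scales_def)
next
  fix \<alpha> \<xi> assume "\<alpha> \<in> scales" "\<xi> \<in> points (X \<alpha>)"
  then show "scaling_map star M d \<alpha> \<alpha> \<xi> = \<xi>"
    by (auto simp: scales_def scaling_map_proj)
next
  fix \<alpha> \<beta> \<gamma> \<xi>
  assume "\<alpha> \<in> scales" "\<beta> \<in> scales" "\<gamma> \<in> scales" "\<gamma> \<le> \<beta> \<and> \<beta> \<le> \<alpha>" "\<xi> \<in> points (X \<alpha>)"
  then show "scaling_map star M d \<gamma> \<beta> (scaling_map star M d \<beta> \<alpha> \<xi>) = scaling_map star M d \<gamma> \<alpha> \<xi>"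
    by (auto simp: scales_def scaling_map_proj)
qed (simp add: generalized_galactic_scaling scales_def)

end

section \<open>The limit\<close>

context nonstandard_metric
begin

abbreviation "L \<equiv> limit_space star M d"

lemma small_dist_limit: "small_dist L \<xi> \<eta> = (if \<xi> = \<eta> then 0 else Pinf)"
  by (simp add: limit_space_def)

lemma large_dist_limit: "large_dist L E F = (if E = F then 0 else Pinf)"
  by (simp add: limit_space_def)

lemma points_limit_iff:
  "\<xi> \<in> points L \<longleftrightarrow> \<xi> \<in> Pi\<^sub>E scales (\<lambda>\<alpha>. points (X \<alpha>)) \<and>
    (\<forall>\<alpha>\<in>scales. \<forall>\<beta>\<in>scales. \<beta> \<le> \<alpha> \<longrightarrow> scaling_map star M d \<beta> \<alpha> (\<xi> \<alpha>) = \<xi> \<beta>)"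
  by (simp only: limit_space_def limit_points_def scaling_def fst_conv mem_Collect_eq)

lemma limit_map_eq: "\<xi> \<in> points L \<Longrightarrow> limit_map star M d \<alpha> \<xi> = \<xi> \<alpha>"
  by (simp add: limit_map_def limit_space_def)

lemma limit_points_scaled:
  assumes "\<xi> \<in> points L" "0 < \<alpha>" shows "\<xi> \<alpha> \<in> points (X \<alpha>)"
proof -
  have "\<xi> \<in> Pi\<^sub>E scales (\<lambda>\<alpha>. points (X \<alpha>))"
    using assms(1) unfolding points_limit_iff by (rule conjunct1)
  moreover have "\<alpha> \<in> scales"
    using assms(2) by (simp add: scales_def)
  ultimately show ?thesis
    by (rule PiE_mem)
qed

lemma generalized_galactic_limit: "generalized_galactic L"
  by (simp add: generalized_galactic_def limit_space_def metric_rule_discrete)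

lemma component_limit: "\<xi> \<in> points L \<Longrightarrow> component L \<xi> = {\<xi>}"
  by (auto simp: component_def small_dist_limit zero_extended_def split: if_splits)

text \<open>Distances in the limit are 0 or infinite, so only coinciding points and components need
  checking, and there the distances in the scaling vanish.\<close>

lemma morphism_limit_map:
  assumes \<alpha>: "0 < \<alpha>" shows "morphism (star_real star) L (X \<alpha>) (limit_map star M d \<alpha>)"
proof (rule nonexpanding_morphismI)
  note X = generalized_galactic_scaling[OF \<alpha>, unfolded generalized_galactic_def]
  show "generalized_galactic L" "generalized_galactic (X \<alpha>)"
    using generalized_galactic_limit generalized_galactic_scaling[OF \<alpha>] by blast+
  show "limit_map star M d \<alpha> \<in> points L \<rightarrow>\<^sub>E points (X \<alpha>)"
  proof (rule PiE_I)
    show "limit_map star M d \<alpha> \<xi> \<in> points (X \<alpha>)" if "\<xi> \<in> points L" for \<xi>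
      using limit_map_eq[OF that] limit_points_scaled[OF that \<alpha>] by simp
    show "limit_map star M d \<alpha> \<xi> = undefined" if "\<xi> \<notin> points L" for \<xi>
      using that by (simp add: limit_map_def limit_space_def)
  qed
  {
    fix \<xi> \<eta> assume "\<xi> \<in> points L" "\<eta> \<in> points L"
    then show "small_dist (X \<alpha>) (limit_map star M d \<alpha> \<xi>) (limit_map star M d \<alpha> \<eta>) \<le> small_dist L \<xi> \<eta>"
      using metric_rule_refl[OF conjunct1[OF X] limit_points_scaled[OF _ \<alpha>]]
      by (simp add: small_dist_limit limit_map_eq del: points_scaling)
  }
  fix E F \<xi> \<eta> assume EF: "E \<in> comps L" "F \<in> comps L" "\<xi> \<in> E" "\<eta> \<in> F"
  then have pts: "\<xi> \<in> points L" "\<eta> \<in> points L" "E = {\<xi>}" "F = {\<eta>}"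
    by (auto simp: comps_eq component_limit)
  have "component (X \<alpha>) (\<xi> \<alpha>) \<in> comps (X \<alpha>)"
    using pts limit_points_scaled[OF _ \<alpha>] by (intro componentI)
  then show "large_dist (X \<alpha>) (component (X \<alpha>) (limit_map star M d \<alpha> \<xi>))
      (component (X \<alpha>) (limit_map star M d \<alpha> \<eta>)) \<le> large_dist L E F"
    using metric_rule_refl[OF conjunct2[OF X]] pts(1,2)
    by (auto simp: large_dist_limit pts(3,4) limit_map_eq simp del: points_scaling)
qed

lemma cone_limit:
  "cone (star_real star) scales X (scaling_map star M d) L (limit_map star M d)"
  unfolding cone_def
proof (intro conjI ballI impI)
  show "generalized_galactic L"
    by (rule generalized_galactic_limit)
  show "morphism (star_real star) L (X \<alpha>) (limit_map star M d \<alpha>)" if "\<alpha> \<in> scales" for \<alpha>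
    using morphism_limit_map that by (simp add: scales_def)
  fix \<alpha> \<beta> :: 'r and \<xi> assume *: "\<alpha> \<in> scales" "\<beta> \<in> scales" "\<beta> \<le> \<alpha>" "\<xi> \<in> points L"
  then show "scaling_map star M d \<beta> \<alpha> (limit_map star M d \<alpha> \<xi>) = limit_map star M d \<beta> \<xi>"
    unfolding limit_map_eq[OF *(4)] points_limit_iff by blast
qed

text \<open>The galactic inequality says that the scaled distance is at most
  \<open>\<gamma> * t\<close> up to a limited error. With a natural bound \<open>n\<close> for
  \<open>\<gamma>\<close> and \<open>m\<close> for the error, \<open>k = n + m\<close> works, since
  \<open>\<bar>t\<bar> + 1\<close> dominates both \<open>\<bar>t\<bar>\<close> and 1. The constant
  may depend on \<open>\<alpha>\<close>; what counts is that it is a standard natural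
  number.\<close>

lemma cone_large_dist_bound:
  assumes cone: "cone (star_real star) scales X (scaling_map star M d) K g"
    and EF: "E \<in> comps K" "F \<in> comps K" "u \<in> E" "v \<in> F"
    and fin: "large_dist K E F = Fin (Gal t)"
    and \<alpha>: "0 < \<alpha>" and xy: "x \<in> starM" "y \<in> starM" "g \<alpha> u = proj \<alpha> x" "g \<alpha> v = proj \<alpha> y"
  obtains k :: nat where "\<alpha> * stard x y \<le> of_nat k * (\<bar>t\<bar> + 1)"
proof -
  have K: "generalized_galactic K" and g: "morphism (star_real star) K (X \<alpha>) (g \<alpha>)"
    using cone \<alpha> by (simp_all add: cone_def scales_def)
  have ind: "induced K (X \<alpha>) (g \<alpha>) E = component (X \<alpha>) (proj \<alpha> x)"
    "induced K (X \<alpha>) (g \<alpha>) F = component (X \<alpha>) (proj \<alpha> y)"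
    using induced_morphism[OF K generalized_galactic_scaling[OF \<alpha>] g] EF xy by simp_all
  have "large_dist (X \<alpha>) (component (X \<alpha>) (proj \<alpha> x)) (component (X \<alpha>) (proj \<alpha> y))
      = Fin (Gal (\<alpha> * stard x y))"
    using xy \<alpha> metric_rule_small_dist_scaling[OF \<alpha>]
    by (intro large_dist_scaling componentI component_self) simp_all
  moreover obtain \<gamma> where \<gamma>: "limited \<gamma>"
    "large_dist (X \<alpha>) (induced K (X \<alpha>) (g \<alpha>) E) (induced K (X \<alpha>) (g \<alpha>) F)
      \<le> map_extended (gal_scale \<gamma>) (large_dist K E F)"
    using g EF unfolding morphism_def by blast
  ultimately have "Gal (\<alpha> * stard x y) \<le> Gal (\<gamma> * t)"
    by (simp add: ind fin gal_scale_Gal)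
  then have "\<alpha> * stard x y \<le> \<gamma> * t \<or> limited (\<alpha> * stard x y - \<gamma> * t)"
    by (simp add: Gal_le_iff)
  then obtain m :: nat where m: "\<alpha> * stard x y \<le> \<gamma> * t + of_nat m"
  proof
    assume "\<alpha> * stard x y \<le> \<gamma> * t"
    then show thesis
      using that[of 0] by simp
  next
    assume "limited (\<alpha> * stard x y - \<gamma> * t)"
    then obtain m :: nat where "\<bar>\<alpha> * stard x y - \<gamma> * t\<bar> \<le> of_nat m"
      unfolding limited_iff by blast
    then show thesis
      using that[of m] by linarith
  qed
  obtain n :: nat where n: "\<bar>\<gamma>\<bar> \<le> of_nat n"
    using \<gamma>(1) unfolding limited_iff by blast
  have "\<gamma> * t \<le> of_nat n * \<bar>t\<bar>"
    using mult_right_mono[OF n abs_ge_zero[of t]] abs_ge_self[of "\<gamma> * t"] by (simp add: abs_mult)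
  moreover have "(0::'r) \<le> of_nat m * \<bar>t\<bar>" "(0::'r) \<le> of_nat n"
    by simp_all
  ultimately have "\<alpha> * stard x y \<le> of_nat (n + m) * (\<bar>t\<bar> + 1)"
    using m unfolding of_nat_add distrib_left distrib_right mult_1_right by linarith
  then show thesis
    using that by blast
qed

text \<open>The heart of the universal property: the points are compared at a much larger scale, and
  the estimate obtained there is brought back to \<open>\<alpha>\<close> by the compatibility of the
  cone.\<close>

lemma cone_collapse:
  assumes cone: "cone (star_real star) scales X (scaling_map star M d) K g"
    and EF: "E \<in> comps K" "F \<in> comps K" "u \<in> E" "v \<in> F"
    and fin: "large_dist K E F \<noteq> Pinf" and \<alpha>: "0 < \<alpha>"
  shows "g \<alpha> u = g \<alpha> v"
proof -
  have K: "generalized_galactic K"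
    using cone by (simp add: cone_def)
  then have "0 \<le> large_dist K E F"
    using EF by (intro metric_rule_nonneg) (auto simp: generalized_galactic_def)
  \<comment> \<open>Nonnegativity rules out \<open>Minf\<close>, so a value other than
    \<open>Pinf\<close> is a galaxy.\<close>
  then obtain t where t: "large_dist K E F = Fin (Gal t)"
    using fin Gal_cases by (cases "large_dist K E F") (auto simp: zero_extended_def)
  obtain \<omega> :: 'r where \<omega>: "of_nat n < \<omega>" for n :: nat
    using unlimited_exists by blast
  \<comment> \<open>The bound \<open>k\<close> is known only once \<open>\<alpha>'\<close> is fixed,
    but \<open>\<omega>\<close> exceeds every standard natural number and therefore any such
    \<open>k\<close>. The factor \<open>\<bar>t\<bar> + 1\<close> cancels the one in
    \<open>cone_large_dist_bound\<close>; being at least 1, it also keeps \<open>\<alpha>'\<close>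
    above \<open>\<alpha>\<close>.\<close>
  define \<alpha>' where "\<alpha>' = \<alpha> * (\<omega> * (\<bar>t\<bar> + 1))"
  have \<omega>_gt: "1 < \<omega>"
    using \<omega>[of 1] by simp
  have t_pos: "0 < \<bar>t\<bar> + 1"
    using abs_ge_zero[of t] by linarith
  have "1 * 1 \<le> \<omega> * (\<bar>t\<bar> + 1)"
    using \<omega>_gt by (intro mult_mono) auto
  then have \<alpha>': "\<alpha> \<le> \<alpha>'" "0 < \<alpha>'"
    using mult_left_mono[of 1 "\<omega> * (\<bar>t\<bar> + 1)" \<alpha>] \<alpha> by (auto simp: \<alpha>'_def)
  have uv: "u \<in> points K" "v \<in> points K"
    using EF comps_subset_points K by (auto simp: generalized_galactic_def)
  have "g \<alpha>' w \<in> points (X \<alpha>')" if "w \<in> points K" for w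
    using cone \<alpha>' that by (auto simp: cone_def scales_def morphism_def simp del: points_scaling)
  then obtain x y where xy: "x \<in> starM" "y \<in> starM" "g \<alpha>' u = proj \<alpha>' x" "g \<alpha>' v = proj \<alpha>' y"
    using uv unfolding points_scaling by (metis imageE)
  obtain k :: nat where "\<alpha>' * stard x y \<le> of_nat k * (\<bar>t\<bar> + 1)"
    using cone_large_dist_bound[OF cone EF t \<alpha>'(2) xy] by blast
  then have "\<omega> * (\<alpha> * stard x y) * (\<bar>t\<bar> + 1) \<le> of_nat k * (\<bar>t\<bar> + 1)"
    by (simp add: \<alpha>'_def mult_ac)
  then have k: "\<omega> * (\<alpha> * stard x y) \<le> of_nat k"
    using t_pos by (rule mult_right_le_imp_le)
  have "infinitely_small (\<alpha> * stard x y)"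
    unfolding infinitely_small_def
  proof (intro allI impI)
    fix n :: nat assume n: "1 \<le> n"
    \<comment> \<open>Here \<open>k * n\<close> is again a standard natural number, hence below
      \<open>\<omega>\<close>; cancelling \<open>\<omega>\<close> leaves the required bound.\<close>
    have "\<omega> * (\<alpha> * stard x y) * of_nat n \<le> of_nat (k * n)"
      using mult_right_mono[OF k, of "of_nat n"] by simp
    also have "\<dots> < \<omega>"
      by (rule \<omega>)
    finally have "\<omega> * (\<alpha> * stard x y * of_nat n) < \<omega> * 1"
      by (simp add: mult_ac)
    then have "\<alpha> * stard x y * of_nat n < 1"
      using \<omega>_gt by (simp add: mult_less_cancel_left)
    then show "\<bar>\<alpha> * stard x y\<bar> < 1 / of_nat n"
      using n scaled_dist_nonneg[OF \<alpha> xy(1,2)] by (simp add: pos_less_divide_eq)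
  qed
  then have "proj \<alpha> x = proj \<alpha> y"
    using proj_eq_iff[OF \<alpha> xy(1,2)] by blast
  moreover have "scaling_map star M d \<alpha> \<alpha>' (g \<alpha>' w) = g \<alpha> w" if "w \<in> points K" for w
    using cone that \<alpha> \<alpha>' by (simp add: cone_def scales_def)
  ultimately show ?thesis
    using uv xy scaling_map_proj[OF \<alpha> \<alpha>'(1)] by metis
qed

text \<open>The outer restriction makes the lift an extensional map, as morphisms must be; the inner
  one makes each value an extensional family, as points of the limit must be.\<close>

definition cone_lift :: "('f, 'r) space \<Rightarrow> ('r \<Rightarrow> 'f \<Rightarrow> 'y set) \<Rightarrow> 'f \<Rightarrow> 'r \<Rightarrow> 'y set" where
  "cone_lift K g = (\<lambda>u\<in>points K. \<lambda>\<alpha>\<in>scales. g \<alpha> u)"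

section \<open>Factorisation of cones through the limit\<close>

lemma cone_lift_points:
  assumes cone: "cone (star_real star) scales X (scaling_map star M d) K g"
    and u: "u \<in> points K"
  shows "cone_lift K g u \<in> points L"
proof -
  have "g \<alpha> u \<in> points (X \<alpha>)" if "\<alpha> \<in> scales" for \<alpha>
    using cone u that by (auto simp: cone_def morphism_def simp del: points_scaling)
  then have "cone_lift K g u \<in> Pi\<^sub>E scales (\<lambda>\<alpha>. points (X \<alpha>))"
    using u by (simp add: cone_lift_def del: points_scaling)
  moreover have "scaling_map star M d \<beta> \<alpha> (g \<alpha> u) = g \<beta> u"
    if "\<alpha> \<in> scales" "\<beta> \<in> scales" "\<beta> \<le> \<alpha>" for \<alpha> \<beta>
    using cone u that by (simp add: cone_def)
  ultimately show ?thesis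
    unfolding points_limit_iff using u by (simp add: cone_lift_def)
qed

text \<open>Where a distance in \<open>K\<close> is finite, \<open>cone_collapse\<close> makes the
  lifted points equal; where it is infinite, the bound is trivial.\<close>

lemma morphism_cone_lift:
  assumes cone: "cone (star_real star) scales X (scaling_map star M d) K g"
  shows "morphism (star_real star) K L (cone_lift K g)"
proof (rule nonexpanding_morphismI)
  show K: "generalized_galactic K"
    using cone by (simp add: cone_def)
  then have K_small: "metric_rule (points K) (small_dist K)"
    and K_large: "metric_rule (comps K) (large_dist K)"
    by (simp_all add: generalized_galactic_def)
  show "generalized_galactic L"
    by (rule generalized_galactic_limit)
  show "cone_lift K g \<in> points K \<rightarrow>\<^sub>E points L"
    using cone_lift_points[OF cone] by (auto simp: cone_lift_def)
  have collapse: "cone_lift K g u = cone_lift K g v"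
    if "E \<in> comps K" "F \<in> comps K" "u \<in> E" "v \<in> F" "large_dist K E F \<noteq> Pinf" for E F u v
  proof -
    have "u \<in> points K" "v \<in> points K"
      using that comps_subset_points[OF K_small] by blast+
    then show ?thesis
      using cone_collapse[OF cone that] by (auto simp: cone_lift_def scales_def intro!: restrict_ext)
  qed
  {
    fix u v assume uv: "u \<in> points K" "v \<in> points K"
    show "small_dist L (cone_lift K g u) (cone_lift K g v) \<le> small_dist K u v"
    proof (cases "small_dist K u v < Pinf")
      case True
      \<comment> \<open>Points at finite small distance share a component, whose large distance to
        itself is 0, so the collapse applies with both components equal.\<close>
      have comp: "component K u \<in> comps K"
        using uv by (simp add: componentI)
      then have "large_dist K (component K u) (component K u) \<noteq> Pinf"
        using metric_rule_refl[OF K_large comp] by (simp add: zero_extended_def)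
      then have "cone_lift K g u = cone_lift K g v"
        using True uv component_self[OF K_small uv(1)]
        by (intro collapse[OF comp comp]) (simp_all add: component_def)
      moreover have "0 \<le> small_dist K u v"
        using metric_rule_nonneg[OF K_small uv] .
      ultimately show ?thesis
        by (simp add: small_dist_limit)
    next
      case False
      then have "small_dist K u v = Pinf"
        by (cases "small_dist K u v") auto
      then show ?thesis
        by simp
    qed
  }
  fix E F u v assume EF: "E \<in> comps K" "F \<in> comps K" "u \<in> E" "v \<in> F"
  show "large_dist L (component L (cone_lift K g u)) (component L (cone_lift K g v))
      \<le> large_dist K E F"
  proof (cases "large_dist K E F = Pinf")
    case False
    moreover have "0 \<le> large_dist K E F"
      using metric_rule_nonneg[OF K_large EF(1,2)] .
    ultimately show ?thesis
      using collapse[OF EF] by (simp add: large_dist_limit)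
  qed simp
qed

lemma inverse_limit_scaling:
  "inverse_limit TYPE('f) (star_real star) scales X (scaling_map star M d) L (limit_map star M d)"
  unfolding inverse_limit_def
proof (intro conjI allI impI)
  fix K :: "('f, 'r) space" and g
  assume cone: "cone (star_real star) scales X (scaling_map star M d) K g"
  show "\<exists>!h. morphism (star_real star) K L h \<and>
      (\<forall>\<alpha>\<in>scales. \<forall>u\<in>points K. limit_map star M d \<alpha> (h u) = g \<alpha> u)"
  proof (rule ex1I)
    show "morphism (star_real star) K L (cone_lift K g) \<and>
        (\<forall>\<alpha>\<in>scales. \<forall>u\<in>points K. limit_map star M d \<alpha> (cone_lift K g u) = g \<alpha> u)"
      using morphism_cone_lift[OF cone] limit_map_eq[OF cone_lift_points[OF cone]]
      by (simp add: cone_lift_def)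
  next
    fix h
    assume h: "morphism (star_real star) K L h \<and>
      (\<forall>\<alpha>\<in>scales. \<forall>u\<in>points K. limit_map star M d \<alpha> (h u) = g \<alpha> u)"
    then have h_ext: "h \<in> points K \<rightarrow>\<^sub>E points L"
      by (simp add: morphism_def)
    moreover have "cone_lift K g \<in> points K \<rightarrow>\<^sub>E points L"
      using cone_lift_points[OF cone] by (auto simp: cone_lift_def)
    moreover have "h u = cone_lift K g u" if u: "u \<in> points K" for u
    proof -
      have hu: "h u \<in> points L"
        using PiE_mem[OF h_ext u] .
      \<comment> \<open>The limit maps determine \<open>h u\<close> at scales only; extensionality
        settles its values at all other indices.\<close>
      then have "h u \<in> extensional scales"
        unfolding points_limit_iff PiE_def by blast
      moreover have "h u \<alpha> = g \<alpha> u" if "\<alpha> \<in> scales" for \<alpha>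
        using h u that limit_map_eq[OF hu] by metis
      ultimately have "h u = (\<lambda>\<alpha>\<in>scales. g \<alpha> u)"
        by (intro extensionalityI[of _ scales]) simp_all
      then show ?thesis
        using u by (simp add: cone_lift_def)
    qed
    ultimately show "h = cone_lift K g"
      by (rule PiE_ext)
  qed
qed (rule inverse_system_scaling cone_limit)+

end

theorem proposition7:
  fixes star :: "('x, 'y, 'r::linordered_field) star_map"
    and M :: "'x set" and d :: "'x \<Rightarrow> 'x \<Rightarrow> real"
  assumes "nonstandard_model star"
    and "Metric_space M d"
  shows "inverse_limit TYPE('f) (star_real star) scales
           (scaling star M d) (scaling_map star M d)
           (limit_space star M d) (limit_map star M d)"
proof -
  interpret nonstandard_metric star M d
    using assms by (intro nonstandard_metric.intro nonstandard_extension.intro)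
  show ?thesis
    by (rule inverse_limit_scaling)
qed

end
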